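(* The algebra $H_1=\{u\in U(\mathfrak{b})\mid u(d_{-1}-1)\in(d_{-1}-1)U(\mathfrak{W})\}$ is isomorphic to the algebra $H_1'=\mathrm{End}_{\mathfrak{W}}(Q_1')$.
   Context: All vector spaces and Lie algebras are over $\mathbb{C}$. Let $\mathfrak{W}=\mathrm{Der}_{\mathbb{C}}\,\mathbb{C}[x]$, the Lie algebra with basis $d_i=x^{i+1}\frac{\partial}{\partial x}$, $i\in\mathbb{Z}_{\ge -1}$, and bracket $[d_i,d_j]=(j-i)d_{i+j}$. Let $\mathfrak{b}=\mathrm{span}\{d_i\mid i\in\mathbb{Z}_{\ge 0}\}$, a Lie subalgebra of $\mathfrak{W}$. The set $H_1$ is a subalgebra of $U(\mathfrak{b})$. Let $N_1=\mathbb{C}v_1$ be the one-dimensional right $\mathbb{C}[d_{-1}]$-module with $v_1\cdot d_{-1}=v_1$. Let $Q_1'=N_1\otimes_{\mathbb{C}[d_{-1}]}U(\mathfrak{W})$ be the right $U(\mathfrak{W})$-module induced from $N_1$, and let $H_1'=\mathrm{End}_{\mathfrak{W}}(Q_1')$ be its algebra of right $U(\mathfrak{W})$-module endomorphisms, with multiplication given by composition of maps. *)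

theory Defs
  imports
    Complex_Main
    "HOL-Computational_Algebra.Polynomial"
    "HOL-Library.Poly_Mapping"
begin

section \<open>Vector spaces, algebras and Lie algebras over the complex numbers\<close>

class scaleC =
  fixes scaleC :: "complex \<Rightarrow> 'a \<Rightarrow> 'a"  (infixr \<open>*\<^sub>C\<close> 75)

class complex_vector = scaleC + ab_group_add +
  assumes scaleC_add_right: "a *\<^sub>C (x + y) = a *\<^sub>C x + a *\<^sub>C y"
    and scaleC_add_left: "(a + b) *\<^sub>C x = a *\<^sub>C x + b *\<^sub>C x"
    and scaleC_scaleC: "a *\<^sub>C (b *\<^sub>C x) = (a * b) *\<^sub>C x"
    and scaleC_one: "1 *\<^sub>C x = x"

global_interpretation complex_vector: vector_space "scaleC :: complex \<Rightarrow> 'a \<Rightarrow> 'a::complex_vector"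
  defines cspan = complex_vector.span
  by unfold_locales (simp_all add: scaleC_add_right scaleC_add_left scaleC_scaleC scaleC_one)

text \<open>Associative unital algebras. The zero algebra is allowed, so this does not extend
  \<^class>\<open>ring_1\<close>.\<close>

class complex_algebra = complex_vector + ring + monoid_mult +
  assumes mult_scaleC_left: "(a *\<^sub>C x) * y = a *\<^sub>C (x * y)"
    and mult_scaleC_right: "x * (a *\<^sub>C y) = a *\<^sub>C (x * y)"

definition algebra_iso :: "('a::complex_algebra \<Rightarrow> 'b::complex_algebra) \<Rightarrow> bool" where
  "algebra_iso f \<longleftrightarrow> bij f \<and>
     (\<forall>x y. f (x + y) = f x + f y) \<and>
     (\<forall>c x. f (c *\<^sub>C x) = c *\<^sub>C f x) \<and>
     (\<forall>x y. f (x * y) = f x * f y) \<and>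
     f 1 = 1"

class lie_algebra = complex_vector +
  fixes lie_bracket :: "'a \<Rightarrow> 'a \<Rightarrow> 'a"
  assumes lie_add_left: "lie_bracket (x + y) z = lie_bracket x z + lie_bracket y z"
    and lie_add_right: "lie_bracket x (y + z) = lie_bracket x y + lie_bracket x z"
    and lie_scaleC_left: "lie_bracket (a *\<^sub>C x) y = a *\<^sub>C lie_bracket x y"
    and lie_scaleC_right: "lie_bracket x (a *\<^sub>C y) = a *\<^sub>C lie_bracket x y"
    and lie_self: "lie_bracket x x = 0"
    and lie_jacobi: "lie_bracket x (lie_bracket y z) + lie_bracket y (lie_bracket z x)
      + lie_bracket z (lie_bracket x y) = 0"


section \<open>Universal enveloping algebras\<close>

text \<open>Lists are words under concatenation, so that \<open>'a list \<Rightarrow>\<^sub>0 complex\<close>, with the convolution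
  product of \<^theory>\<open>HOL-Library.Poly_Mapping\<close>, is the free associative algebra on the set of all
  elements of \<open>'a\<close>.\<close>

instantiation list :: (type) monoid_add
begin

definition zero_list :: "'a list" where "zero_list = []"
definition plus_list :: "'a list \<Rightarrow> 'a list \<Rightarrow> 'a list" where "plus_list = (@)"

instance by standard (simp_all add: zero_list_def plus_list_def)

end

inductive_set two_sided_ideal :: "'r::ring_1 set \<Rightarrow> 'r set" for S :: "'r set" where
  ideal_gen: "s \<in> S \<Longrightarrow> s \<in> two_sided_ideal S"
| ideal_zero: "0 \<in> two_sided_ideal S"
| ideal_add: "a \<in> two_sided_ideal S \<Longrightarrow> b \<in> two_sided_ideal S \<Longrightarrow> a + b \<in> two_sided_ideal S"
| ideal_left: "a \<in> two_sided_ideal S \<Longrightarrow> r * a \<in> two_sided_ideal S"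
| ideal_right: "a \<in> two_sided_ideal S \<Longrightarrow> a * r \<in> two_sided_ideal S"

lemma ideal_uminus: "a \<in> two_sided_ideal S \<Longrightarrow> - a \<in> two_sided_ideal S"
  using ideal_left[of a S "-1"] by simp

lemma ideal_diff: "a \<in> two_sided_ideal S \<Longrightarrow> b \<in> two_sided_ideal S \<Longrightarrow> a - b \<in> two_sided_ideal S"
  using ideal_add[OF _ ideal_uminus, of a S b] by simp

abbreviation word :: "'a list \<Rightarrow> 'a list \<Rightarrow>\<^sub>0 complex" where
  "word w \<equiv> Poly_Mapping.single w 1"

lemma word_Nil: "word [] = 1"
  by (simp flip: single_one add: zero_list_def)

text \<open>The first two families of relations turn the free algebra on the set underlying \<open>'a\<close> into
  the tensor algebra of the vector space \<open>'a\<close>; the third imposes \<open>x \<otimes> y - y \<otimes> x = [x, y]\<close>.\<close>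

definition uea_relations :: "('a::lie_algebra list \<Rightarrow>\<^sub>0 complex) set" where
  "uea_relations =
     {word [x + y] - word [x] - word [y] | x y. True} \<union>
     {word [c *\<^sub>C x] - Poly_Mapping.single [x] c | c x. True} \<union>
     {word [x, y] - word [y, x] - word [lie_bracket x y] | x y. True}"

quotient_type (overloaded) 'a uea = "'a::lie_algebra list \<Rightarrow>\<^sub>0 complex" /
  "\<lambda>p q. p - q \<in> two_sided_ideal uea_relations"
proof (rule equivpI)
  show "reflp (\<lambda>p q. p - q \<in> two_sided_ideal (uea_relations :: ('a list \<Rightarrow>\<^sub>0 complex) set))"
    by (rule reflpI) (simp add: ideal_zero)
  show "symp (\<lambda>p q. p - q \<in> two_sided_ideal (uea_relations :: ('a list \<Rightarrow>\<^sub>0 complex) set))"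
    by (rule sympI) (drule ideal_uminus, simp)
  show "transp (\<lambda>p q. p - q \<in> two_sided_ideal (uea_relations :: ('a list \<Rightarrow>\<^sub>0 complex) set))"
    by (rule transpI) (drule (1) ideal_add, simp)
qed

lemma free_algebra_induct [case_names single add]:
  fixes p :: "'a list \<Rightarrow>\<^sub>0 complex"
  assumes "\<And>w c. P (Poly_Mapping.single w c)" "\<And>p q. P p \<Longrightarrow> P q \<Longrightarrow> P (p + q)"
  shows "P p"
proof -
  have "P (\<Sum>w\<in>A. Poly_Mapping.single w (Poly_Mapping.lookup p w))" if "finite A" for A
    using that
  proof induction
    case empty
    show ?case using assms(1)[of "[]" 0] by simp
  qed (simp add: assms)
  moreover have "(\<Sum>w\<in>Poly_Mapping.keys p. Poly_Mapping.single w (Poly_Mapping.lookup p w)) = p"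
    by (rule poly_mapping_eqI) (simp add: lookup_sum lookup_single when_def in_keys_iff)
  ultimately show ?thesis by (metis finite_keys)
qed

lemma single_Nil_commute: "Poly_Mapping.single [] c * p = p * Poly_Mapping.single [] (c::complex)"
  by (induction p rule: free_algebra_induct)
    (simp_all add: mult_single plus_list_def mult.commute distrib_left distrib_right)

instantiation uea :: (lie_algebra) complex_algebra
begin

lift_definition zero_uea :: "'a uea" is 0 .
lift_definition one_uea :: "'a uea" is 1 .
lift_definition plus_uea :: "'a uea \<Rightarrow> 'a uea \<Rightarrow> 'a uea" is "(+)"
  by (drule (1) ideal_add) (simp add: algebra_simps)
lift_definition uminus_uea :: "'a uea \<Rightarrow> 'a uea" is uminus
  by (drule ideal_uminus) (simp add: algebra_simps)
lift_definition minus_uea :: "'a uea \<Rightarrow> 'a uea \<Rightarrow> 'a uea" is "(-)"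
  by (drule (1) ideal_diff) (simp add: algebra_simps)
lift_definition times_uea :: "'a uea \<Rightarrow> 'a uea \<Rightarrow> 'a uea" is "(*)"
proof -
  fix p p' q q' :: "'a list \<Rightarrow>\<^sub>0 complex"
  assume "p - p' \<in> two_sided_ideal uea_relations" "q - q' \<in> two_sided_ideal uea_relations"
  then have "(p - p') * q + p' * (q - q') \<in> two_sided_ideal uea_relations"
    by (intro ideal_add ideal_left ideal_right)
  then show "p * q - p' * q' \<in> two_sided_ideal uea_relations"
    by (simp add: algebra_simps)
qed
lift_definition scaleC_uea :: "complex \<Rightarrow> 'a uea \<Rightarrow> 'a uea" is
  "\<lambda>c p. Poly_Mapping.single [] c * p"
  by (metis ideal_left right_diff_distrib)

instance
proof
  fix a b c :: "'a uea" and r s :: complex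
  have eqI: "p - q \<in> two_sided_ideal uea_relations" if "p = q" for p q :: "'a list \<Rightarrow>\<^sub>0 complex"
    using that by (simp add: ideal_zero)
  show "a + b + c = a + (b + c)" by transfer (rule eqI, simp add: algebra_simps)
  show "a + b = b + a" by transfer (rule eqI, simp add: algebra_simps)
  show "0 + a = a" by transfer (rule eqI, simp)
  show "- a + a = 0" by transfer (rule eqI, simp)
  show "a - b = a + - b" by transfer (rule eqI, simp)
  show "a * b * c = a * (b * c)" by transfer (rule eqI, simp add: algebra_simps)
  show "(a + b) * c = a * c + b * c" by transfer (rule eqI, simp add: algebra_simps)
  show "a * (b + c) = a * b + a * c" by transfer (rule eqI, simp add: algebra_simps)
  show "1 * a = a" by transfer (rule eqI, simp)
  show "a * 1 = a" by transfer (rule eqI, simp)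
  show "r *\<^sub>C (a + b) = r *\<^sub>C a + r *\<^sub>C b" by transfer (rule eqI, simp add: algebra_simps)
  show "(r + s) *\<^sub>C a = r *\<^sub>C a + s *\<^sub>C a"
    by transfer (rule eqI, simp add: algebra_simps single_add)
  show "r *\<^sub>C (s *\<^sub>C a) = (r * s) *\<^sub>C a"
    by transfer (rule eqI, simp add: mult.assoc[symmetric] mult_single plus_list_def)
  show "1 *\<^sub>C a = a" by transfer (rule eqI, simp add: word_Nil)
  show "(r *\<^sub>C a) * b = r *\<^sub>C (a * b)" by transfer (rule eqI, simp add: mult.assoc)
  show "a * (r *\<^sub>C b) = r *\<^sub>C (a * b)"
  proof (transfer, rule eqI)
    fix r :: complex and a b :: "'a list \<Rightarrow>\<^sub>0 complex"
    show "a * (Poly_Mapping.single [] r * b) = Poly_Mapping.single [] r * (a * b)"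
      by (metis mult.assoc single_Nil_commute)
  qed
qed

end

lift_definition uea_gen :: "'a::lie_algebra \<Rightarrow> 'a uea" is "\<lambda>x. word [x]" .

lemma uea_gen_add: "uea_gen (x + y) = uea_gen x + uea_gen y"
proof transfer
  fix x y :: 'a
  have "word [x + y] - word [x] - word [y] \<in> uea_relations"
    unfolding uea_relations_def by blast
  then show "word [x + y] - (word [x] + word [y]) \<in> two_sided_ideal uea_relations"
    by (metis ideal_gen diff_diff_eq)
qed

lemma uea_gen_scaleC: "uea_gen (c *\<^sub>C x) = c *\<^sub>C uea_gen x"
proof transfer
  fix c :: complex and x :: 'a
  have "word [c *\<^sub>C x] - Poly_Mapping.single [x] c \<in> uea_relations"
    unfolding uea_relations_def by blast
  then show "word [c *\<^sub>C x] - Poly_Mapping.single [] c * word [x] \<in> two_sided_ideal uea_relations"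
    by (simp add: mult_single plus_list_def ideal_gen)
qed

lemma uea_gen_bracket:
  "uea_gen x * uea_gen y - uea_gen y * uea_gen x = uea_gen (lie_bracket x y)"
proof transfer
  fix x y :: 'a
  have "word [x, y] - word [y, x] - word [lie_bracket x y] \<in> uea_relations"
    unfolding uea_relations_def by blast
  then show "word [x] * word [y] - word [y] * word [x] - word [lie_bracket x y]
      \<in> two_sided_ideal uea_relations"
    by (simp add: mult_single plus_list_def ideal_gen)
qed

definition free_eval :: "('a \<Rightarrow> 'b::complex_algebra) \<Rightarrow> ('a list \<Rightarrow>\<^sub>0 complex) \<Rightarrow> 'b" where
  "free_eval f p =
     (\<Sum>w\<in>Poly_Mapping.keys p. Poly_Mapping.lookup p w *\<^sub>C prod_list (map f w))"

lemma free_eval_superset: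
  assumes "finite A" "Poly_Mapping.keys p \<subseteq> A"
  shows "free_eval f p = (\<Sum>w\<in>A. Poly_Mapping.lookup p w *\<^sub>C prod_list (map f w))"
  unfolding free_eval_def using assms
  by (intro sum.mono_neutral_left) (auto simp: in_keys_iff)

lemma free_eval_single: "free_eval f (Poly_Mapping.single w c) = c *\<^sub>C prod_list (map f w)"
  by (subst free_eval_superset[of "{w}"]) auto

lemma free_eval_zero: "free_eval f 0 = 0"
  by (simp add: free_eval_def)

lemma free_eval_add: "free_eval f (p + q) = free_eval f p + free_eval f q"
proof -
  let ?A = "Poly_Mapping.keys p \<union> Poly_Mapping.keys q"
  have "free_eval f (p + q) = (\<Sum>w\<in>?A. Poly_Mapping.lookup (p + q) w *\<^sub>C prod_list (map f w))"
    by (rule free_eval_superset) (use Poly_Mapping.keys_add[of p q] in auto)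
  moreover have "free_eval f p = (\<Sum>w\<in>?A. Poly_Mapping.lookup p w *\<^sub>C prod_list (map f w))"
    "free_eval f q = (\<Sum>w\<in>?A. Poly_Mapping.lookup q w *\<^sub>C prod_list (map f w))"
    by (rule free_eval_superset; auto)+
  ultimately show ?thesis
    by (simp add: lookup_add scaleC_add_left sum.distrib)
qed

lemma free_eval_uminus: "free_eval f (- p) = - free_eval f p"
  using free_eval_add[of f p "- p"] by (simp add: free_eval_zero add_eq_0_iff)

lemma free_eval_diff: "free_eval f (p - q) = free_eval f p - free_eval f q"
  using free_eval_add[of f p "- q"] by (simp add: free_eval_uminus)

lemma free_eval_mult: "free_eval f (p * q) = free_eval f p * free_eval f q"
proof (induction p rule: free_algebra_induct)
  case (single v a)
  show ?case
    by (induction q rule: free_algebra_induct)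
      (simp_all add: mult_single plus_list_def free_eval_single mult_scaleC_left mult_scaleC_right
        scaleC_scaleC free_eval_add distrib_left)
qed (simp add: free_eval_add distrib_right)

lemma free_eval_ideal:
  assumes "\<And>x y. f (x + y) = f x + f y" "\<And>c x. f (c *\<^sub>C x) = c *\<^sub>C f x"
    "\<And>x y. f (lie_bracket x y) = f x * f y - f y * f x"
    and "p \<in> two_sided_ideal uea_relations"
  shows "free_eval f p = 0"
  using assms(4)
proof induction
  case (ideal_gen s)
  then show ?case
    unfolding uea_relations_def
    by (auto simp: free_eval_diff free_eval_single scaleC_one assms(1-3))
qed (simp_all add: free_eval_zero free_eval_add free_eval_mult)


section \<open>The Lie algebra \<open>\<WW>\<close> of derivations of \<open>\<complex>[x]\<close> and its subalgebra \<open>\<bb>\<close>\<close>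

typedef witt = "{D :: complex poly \<Rightarrow> complex poly.
    (\<forall>p q. D (p + q) = D p + D q) \<and> (\<forall>c p. D (smult c p) = smult c (D p)) \<and>
    (\<forall>p q. D (p * q) = D p * q + p * D q)}"
  by (rule exI[of _ "\<lambda>_. 0"]) simp

setup_lifting type_definition_witt

instantiation witt :: lie_algebra
begin

lift_definition zero_witt :: witt is "\<lambda>_. 0" by simp
lift_definition plus_witt :: "witt \<Rightarrow> witt \<Rightarrow> witt" is "\<lambda>D E p. D p + E p"
  by (auto simp: algebra_simps smult_add_right)
lift_definition uminus_witt :: "witt \<Rightarrow> witt" is "\<lambda>D p. - D p"
  by (auto simp: algebra_simps)
lift_definition minus_witt :: "witt \<Rightarrow> witt \<Rightarrow> witt" is "\<lambda>D E p. D p - E p"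
  by (auto simp: algebra_simps smult_diff_right)
lift_definition scaleC_witt :: "complex \<Rightarrow> witt \<Rightarrow> witt" is "\<lambda>c D p. smult c (D p)"
  by (auto simp: algebra_simps smult_add_right)
lift_definition lie_bracket_witt :: "witt \<Rightarrow> witt \<Rightarrow> witt" is "\<lambda>D E p. D (E p) - E (D p)"
  by (auto simp: algebra_simps smult_diff_right)

lemma Rep_witt_diff: "Rep_witt D (p - q) = Rep_witt D p - Rep_witt D q"
proof -
  have "Rep_witt D ((p - q) + q) = Rep_witt D (p - q) + Rep_witt D q"
    using Rep_witt[of D] by blast
  then show ?thesis by simp
qed

instance
proof
  fix a b c :: witt and r s :: complex
  show "a + b + c = a + (b + c)" by transfer (simp add: algebra_simps)
  show "a + b = b + a" by transfer (simp add: algebra_simps)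
  show "0 + a = a" by transfer simp
  show "- a + a = 0" by transfer simp
  show "a - b = a + - b" by transfer simp
  show "r *\<^sub>C (a + b) = r *\<^sub>C a + r *\<^sub>C b" by transfer (simp add: smult_add_right)
  show "(r + s) *\<^sub>C a = r *\<^sub>C a + s *\<^sub>C a" by transfer (simp add: smult_add_left)
  show "r *\<^sub>C (s *\<^sub>C a) = (r * s) *\<^sub>C a" by transfer simp
  show "1 *\<^sub>C a = a" by transfer simp
  show "lie_bracket (a + b) c = lie_bracket a c + lie_bracket b c" by transfer auto
  show "lie_bracket a (b + c) = lie_bracket a b + lie_bracket a c" by transfer auto
  show "lie_bracket (r *\<^sub>C a) b = r *\<^sub>C lie_bracket a b"
    by transfer (auto simp: smult_diff_right)
  show "lie_bracket a (r *\<^sub>C b) = r *\<^sub>C lie_bracket a b"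
    by transfer (auto simp: smult_diff_right)
  show "lie_bracket a a = 0" by transfer simp
  show "lie_bracket a (lie_bracket b c) + lie_bracket b (lie_bracket c a)
      + lie_bracket c (lie_bracket a b) = 0"
    by (rule iffD1[OF Rep_witt_inject], rule ext)
      (simp add: plus_witt.rep_eq lie_bracket_witt.rep_eq zero_witt.rep_eq Rep_witt_diff)
qed

end

text \<open>\<open>d i = x\<^sup>i\<^sup>+\<^sup>1 \<partial>/\<partial>x\<close>, meaningful for \<open>i \<ge> -1\<close> only.\<close>

lift_definition d :: "int \<Rightarrow> witt" is "\<lambda>i p. monom 1 (nat (i + 1)) * pderiv p"
  by (auto simp: pderiv_add pderiv_smult pderiv_mult algebra_simps)

lemma d_bracket:
  assumes "i \<ge> -1" "j \<ge> -1" "i + j \<ge> -1"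
  shows "lie_bracket (d i) (d j) = of_int (j - i) *\<^sub>C d (i + j)"
proof -
  define m n where "m = nat (i + 1)" and "n = nat (j + 1)"
  have eq: "i = int m - 1" "j = int n - 1" and mn: "nat (i + j + 1) = m + n - 1" "m + n \<ge> 1"
    using assms by (auto simp: m_def n_def)
  have c: "of_int (j - i) = (of_nat n - of_nat m :: complex)"
    by (simp add: eq)
  have pd: "monom 1 a * (pderiv (monom 1 b) :: complex poly) = smult (of_nat b) (monom 1 (a + b - 1))"
    for a b
    by (cases b) (simp_all add: pderiv_monom mult_monom smult_monom)
  have "Rep_witt (lie_bracket (d i) (d j)) p = Rep_witt (of_int (j - i) *\<^sub>C d (i + j)) p" for p
  proof -
    have "Rep_witt (lie_bracket (d i) (d j)) p
        = (monom 1 m * pderiv (monom 1 n)) * pderiv p - (monom 1 n * pderiv (monom 1 m)) * pderiv p"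
      unfolding lie_bracket_witt.rep_eq d.rep_eq m_def[symmetric] n_def[symmetric]
      by (simp add: pderiv_mult algebra_simps)
    also have "\<dots> = smult (of_nat n - of_nat m) (monom 1 (m + n - 1)) * pderiv p"
      unfolding pd by (simp add: add.commute[of n m] algebra_simps smult_diff_left)
    also have "\<dots> = Rep_witt (of_int (j - i) *\<^sub>C d (i + j)) p"
      unfolding scaleC_witt.rep_eq d.rep_eq c mn(1) by simp
    finally show ?thesis .
  qed
  then show ?thesis by (intro iffD1[OF Rep_witt_inject] ext)
qed

typedef borel = "cspan {d i | i. i \<ge> 0}"
  using complex_vector.span_zero by blast

setup_lifting type_definition_borel

lemma lie_bracket_zero: "lie_bracket 0 x = 0" "lie_bracket x 0 = 0"
  for x :: "'a::lie_algebra"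
  using lie_add_left[of 0 0 x] lie_add_right[of x 0 0] by simp_all

lemma borel_bracket_closed:
  assumes "x \<in> cspan {d i | i. i \<ge> 0}" "y \<in> cspan {d i | i. i \<ge> 0}"
  shows "lie_bracket x y \<in> cspan {d i | i. i \<ge> 0}"
  using assms(1)
proof (induction rule: complex_vector.span_induct_alt)
  case base
  then show ?case by (simp add: lie_bracket_zero complex_vector.span_zero)
next
  case (step c x z)
  then obtain i where i: "x = d i" "i \<ge> 0" by blast
  have "lie_bracket (d i) y \<in> cspan {d i | i. i \<ge> 0}"
    using assms(2)
  proof (induction rule: complex_vector.span_induct_alt)
    case base
    then show ?case by (simp add: lie_bracket_zero complex_vector.span_zero)
  next
    case (step c' x' z')
    then obtain j where j: "x' = d j" "j \<ge> 0" by blast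
    have "d (i + j) \<in> cspan {d i | i. i \<ge> 0}"
      using i j by (intro complex_vector.span_base CollectI exI[of _ "i + j"]) simp
    then show ?case
      using step.IH i j
      by (auto simp: lie_add_right lie_scaleC_right d_bracket
          intro!: complex_vector.span_add complex_vector.span_scale)
  qed
  then show ?case
    using step.IH i
    by (auto simp: lie_add_left lie_scaleC_left
        intro!: complex_vector.span_add complex_vector.span_scale)
qed

instantiation borel :: lie_algebra
begin

lift_definition zero_borel :: borel is 0 by (rule complex_vector.span_zero)
lift_definition plus_borel :: "borel \<Rightarrow> borel \<Rightarrow> borel" is "(+)"
  by (rule complex_vector.span_add)
lift_definition uminus_borel :: "borel \<Rightarrow> borel" is uminus by (rule complex_vector.span_neg)
lift_definition minus_borel :: "borel \<Rightarrow> borel \<Rightarrow> borel" is "(-)"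
  by (rule complex_vector.span_diff)
lift_definition scaleC_borel :: "complex \<Rightarrow> borel \<Rightarrow> borel" is scaleC
  by (rule complex_vector.span_scale)
lift_definition lie_bracket_borel :: "borel \<Rightarrow> borel \<Rightarrow> borel" is lie_bracket
  by (rule borel_bracket_closed)

instance
  by standard
    (simp_all add: Rep_borel_inject[symmetric] zero_borel.rep_eq plus_borel.rep_eq
      uminus_borel.rep_eq minus_borel.rep_eq scaleC_borel.rep_eq lie_bracket_borel.rep_eq
      scaleC_add_right scaleC_add_left scaleC_scaleC scaleC_one lie_add_left lie_add_right
      lie_scaleC_left lie_scaleC_right lie_self lie_jacobi[unfolded add.assoc] add_ac)

end

text \<open>The algebra homomorphism \<open>U(\<bb>) \<rightarrow> U(\<WW>)\<close> induced by the inclusion \<open>\<bb> \<subseteq> \<WW>\<close>; it is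
  injective by the Poincare-Birkhoff-Witt theorem.\<close>

lift_definition borel_incl :: "borel uea \<Rightarrow> witt uea" is "free_eval (\<lambda>x. uea_gen (Rep_borel x))"
proof -
  fix p q :: "borel list \<Rightarrow>\<^sub>0 complex"
  assume "p - q \<in> two_sided_ideal uea_relations"
  then have "free_eval (\<lambda>x. uea_gen (Rep_borel x)) (p - q) = 0"
    by (intro free_eval_ideal)
      (simp_all add: plus_borel.rep_eq scaleC_borel.rep_eq lie_bracket_borel.rep_eq
        uea_gen_add uea_gen_scaleC uea_gen_bracket)
  then show "free_eval (\<lambda>x. uea_gen (Rep_borel x)) p = free_eval (\<lambda>x. uea_gen (Rep_borel x)) q"
    by (simp add: free_eval_diff)
qed

lemma borel_incl_gen: "borel_incl (uea_gen x) = uea_gen (Rep_borel x)"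
  by transfer (simp add: free_eval_single scaleC_one)

lemma borel_incl_zero: "borel_incl 0 = 0"
  by transfer (simp add: free_eval_zero)

lemma borel_incl_add: "borel_incl (u + v) = borel_incl u + borel_incl v"
  by transfer (simp add: free_eval_add)

lemma borel_incl_uminus: "borel_incl (- u) = - borel_incl u"
  by transfer (simp add: free_eval_uminus)

lemma borel_incl_diff: "borel_incl (u - v) = borel_incl u - borel_incl v"
  by transfer (simp add: free_eval_diff)

lemma borel_incl_mult: "borel_incl (u * v) = borel_incl u * borel_incl v"
  by transfer (simp add: free_eval_mult)

lemma borel_incl_scaleC: "borel_incl (c *\<^sub>C u) = c *\<^sub>C borel_incl u"
  by transfer (simp add: free_eval_mult free_eval_single mult_scaleC_left)

lemma borel_incl_one: "borel_incl 1 = 1"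
  by transfer (simp flip: word_Nil add: free_eval_single scaleC_one)


section \<open>The algebra \<open>H\<^sub>1\<close>\<close>

abbreviation d_minus_1 :: "witt uea"  (\<open>d\<^sub>-\<^sub>1\<close>) where
  "d\<^sub>-\<^sub>1 \<equiv> uea_gen (d (-1))"

typedef H1 = "{u :: borel uea. borel_incl u * (d\<^sub>-\<^sub>1 - 1) \<in> {(d\<^sub>-\<^sub>1 - 1) * w | w. True}}"
  by (rule exI[of _ 0]) (auto simp: borel_incl_zero intro: exI[of _ 0])

setup_lifting type_definition_H1

instantiation H1 :: complex_algebra
begin

lift_definition zero_H1 :: H1 is 0
  by (auto simp: borel_incl_zero intro: exI[of _ 0])
lift_definition one_H1 :: H1 is 1
  by (auto simp: borel_incl_one intro: exI[of _ 1])
lift_definition plus_H1 :: "H1 \<Rightarrow> H1 \<Rightarrow> H1" is "(+)"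
  by (auto simp: borel_incl_add distrib_right distrib_left[symmetric])
lift_definition uminus_H1 :: "H1 \<Rightarrow> H1" is uminus
proof safe
  fix u :: "borel uea" and w :: "witt uea"
  assume "borel_incl u * (d\<^sub>-\<^sub>1 - 1) = (d\<^sub>-\<^sub>1 - 1) * w"
  then have "borel_incl (- u) * (d\<^sub>-\<^sub>1 - 1) = (d\<^sub>-\<^sub>1 - 1) * (- w)"
    by (simp only: borel_incl_uminus mult_minus_left mult_minus_right)
  then show "\<exists>w. borel_incl (- u) * (d\<^sub>-\<^sub>1 - 1) = (d\<^sub>-\<^sub>1 - 1) * w \<and> True" by blast
qed
lift_definition minus_H1 :: "H1 \<Rightarrow> H1 \<Rightarrow> H1" is "(-)"
  by (auto simp: borel_incl_diff left_diff_distrib[of "borel_incl _"] simp flip: right_diff_distrib)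
lift_definition scaleC_H1 :: "complex \<Rightarrow> H1 \<Rightarrow> H1" is scaleC
proof safe
  fix c :: complex and u :: "borel uea" and w :: "witt uea"
  assume "borel_incl u * (d\<^sub>-\<^sub>1 - 1) = (d\<^sub>-\<^sub>1 - 1) * w"
  then have "borel_incl (c *\<^sub>C u) * (d\<^sub>-\<^sub>1 - 1) = (d\<^sub>-\<^sub>1 - 1) * (c *\<^sub>C w)"
    by (simp only: borel_incl_scaleC mult_scaleC_left mult_scaleC_right)
  then show "\<exists>w. borel_incl (c *\<^sub>C u) * (d\<^sub>-\<^sub>1 - 1) = (d\<^sub>-\<^sub>1 - 1) * w \<and> True" by blast
qed
lift_definition times_H1 :: "H1 \<Rightarrow> H1 \<Rightarrow> H1" is "(*)"
proof safe
  fix u v :: "borel uea" and w w' :: "witt uea"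
  assume "borel_incl u * (d\<^sub>-\<^sub>1 - 1) = (d\<^sub>-\<^sub>1 - 1) * w" "borel_incl v * (d\<^sub>-\<^sub>1 - 1) = (d\<^sub>-\<^sub>1 - 1) * w'"
  then have "borel_incl (u * v) * (d\<^sub>-\<^sub>1 - 1) = (d\<^sub>-\<^sub>1 - 1) * (w * w')"
    by (metis borel_incl_mult mult.assoc)
  then show "\<exists>w. borel_incl (u * v) * (d\<^sub>-\<^sub>1 - 1) = (d\<^sub>-\<^sub>1 - 1) * w \<and> True" by blast
qed

instance
  by standard
    (simp_all add: Rep_H1_inject[symmetric] zero_H1.rep_eq one_H1.rep_eq plus_H1.rep_eq
      uminus_H1.rep_eq minus_H1.rep_eq times_H1.rep_eq scaleC_H1.rep_eq
      scaleC_add_right scaleC_add_left scaleC_scaleC scaleC_one mult_scaleC_left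
      mult_scaleC_right distrib_left distrib_right mult.assoc add_ac)

end


section \<open>Tensor products and the induced module \<open>Q\<^sub>1'\<close>\<close>

text \<open>For a right \<open>A\<close>-module \<open>N\<close> and a left \<open>A\<close>-module \<open>M\<close>, the tensor product \<open>N \<otimes>\<^sub>A M\<close> is the free
  abelian group on \<open>N \<times> M\<close> modulo the following subgroup.\<close>

inductive_set tensor_relations ::
    "('n::ab_group_add \<Rightarrow> 'a \<Rightarrow> 'n) \<Rightarrow> ('a \<Rightarrow> 'm::ab_group_add \<Rightarrow> 'm) \<Rightarrow> ('n \<times> 'm \<Rightarrow>\<^sub>0 int) set"
  for ract :: "'n \<Rightarrow> 'a \<Rightarrow> 'n" and lact :: "'a \<Rightarrow> 'm \<Rightarrow> 'm" where
  tensor_zero: "0 \<in> tensor_relations ract lact"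
| tensor_diff: "p \<in> tensor_relations ract lact \<Longrightarrow> q \<in> tensor_relations ract lact \<Longrightarrow>
    p - q \<in> tensor_relations ract lact"
| tensor_add_left:
    "frag_of (n + n', m) - frag_of (n, m) - frag_of (n', m) \<in> tensor_relations ract lact"
| tensor_add_right:
    "frag_of (n, m + m') - frag_of (n, m) - frag_of (n, m') \<in> tensor_relations ract lact"
| tensor_balanced: "frag_of (ract n a, m) - frag_of (n, lact a m) \<in> tensor_relations ract lact"

lemma tensor_uminus:
  "p \<in> tensor_relations ract lact \<Longrightarrow> - p \<in> tensor_relations ract lact"
  using tensor_diff[OF tensor_zero] by fastforce

lemma tensor_add:
  "p \<in> tensor_relations ract lact \<Longrightarrow> q \<in> tensor_relations ract lact \<Longrightarrow>
    p + q \<in> tensor_relations ract lact"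
  using tensor_diff[OF _ tensor_uminus, of p ract lact q] by simp

text \<open>\<open>\<complex>[d\<^sub>-\<^sub>1]\<close> is \<^typ>\<open>complex poly\<close>, with indeterminate \<open>d\<^sub>-\<^sub>1\<close>. It acts on \<open>U(\<WW>)\<close> by left
  multiplication with the value at \<open>d\<^sub>-\<^sub>1 \<in> U(\<WW>)\<close>. On \<open>N\<^sub>1 = \<complex> v\<^sub>1\<close>, which is \<^typ>\<open>complex\<close> with
  \<open>v\<^sub>1 = 1\<close>, the indeterminate acts as the identity.\<close>

definition poly_at :: "complex poly \<Rightarrow> 'a::complex_algebra \<Rightarrow> 'a" where
  "poly_at p a = (\<Sum>i\<le>degree p. coeff p i *\<^sub>C a ^ i)"

definition N1_act :: "complex \<Rightarrow> complex poly \<Rightarrow> complex" where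
  "N1_act z p = z * poly p 1"

definition UW_left_act :: "complex poly \<Rightarrow> witt uea \<Rightarrow> witt uea" where
  "UW_left_act p u = poly_at p d\<^sub>-\<^sub>1 * u"

text \<open>Otherwise the liftings to \<open>Q\<^sub>1'\<close> would also lift the factor \<^typ>\<open>witt uea\<close>.\<close>

lifting_forget uea.lifting
lifting_forget witt.lifting

quotient_type Q1' = "complex \<times> witt uea \<Rightarrow>\<^sub>0 int" /
  "\<lambda>p q. p - q \<in> tensor_relations N1_act UW_left_act"
proof (rule equivpI)
  show "reflp (\<lambda>p q. p - q \<in> tensor_relations N1_act UW_left_act)"
    by (rule reflpI) (simp add: tensor_zero)
  show "symp (\<lambda>p q. p - q \<in> tensor_relations N1_act UW_left_act)"
    by (rule sympI) (drule tensor_uminus, simp)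
  show "transp (\<lambda>p q. p - q \<in> tensor_relations N1_act UW_left_act)"
    by (rule transpI) (drule (1) tensor_add, simp)
qed

text \<open>The right action of \<open>U(\<WW>)\<close> on \<open>Q\<^sub>1'\<close>, with \<open>(n \<otimes> m) \<cdot> u = n \<otimes> m u\<close>.\<close>

definition frag_act :: "(complex \<times> witt uea \<Rightarrow>\<^sub>0 int) \<Rightarrow> witt uea \<Rightarrow> (complex \<times> witt uea \<Rightarrow>\<^sub>0 int)"
  where "frag_act p u = frag_extend (\<lambda>(n, m). frag_of (n, m * u)) p"

lemma frag_act_relations:
  "p \<in> tensor_relations N1_act UW_left_act \<Longrightarrow> frag_act p u \<in> tensor_relations N1_act UW_left_act"
proof (induction rule: tensor_relations.induct)
  case (tensor_balanced n a m)
  have "UW_left_act a m * u = UW_left_act a (m * u)"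
    by (simp add: UW_left_act_def mult.assoc)
  then show ?case
    using tensor_relations.tensor_balanced[of N1_act n a "m * u" UW_left_act]
    by (simp add: frag_act_def frag_extend_diff)
next
  case (tensor_add_right n m m')
  show ?case
    using tensor_relations.tensor_add_right[of n "m * u" "m' * u"]
    by (simp add: frag_act_def frag_extend_diff distrib_right)
qed (simp_all add: frag_act_def frag_extend_diff tensor_relations.intros)

lift_definition Q1'_act :: "Q1' \<Rightarrow> witt uea \<Rightarrow> Q1'"  (infixl \<open>\<cdot>\<close> 70) is frag_act
  using frag_act_relations by (metis frag_act_def frag_extend_diff)

lift_definition Q1'_tensor :: "complex \<Rightarrow> witt uea \<Rightarrow> Q1'" is "\<lambda>n m. frag_of (n, m)" .

lemma Q1'_tensor_act: "Q1'_tensor n m \<cdot> u = Q1'_tensor n (m * u)"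
  by transfer (simp add: frag_act_def tensor_zero)

lemma tensor_eqI:
  "p = q \<Longrightarrow> p - q \<in> tensor_relations ract lact"
  by (simp add: tensor_zero)

instantiation Q1' :: ab_group_add
begin

lift_definition zero_Q1' :: Q1' is 0 .
lift_definition plus_Q1' :: "Q1' \<Rightarrow> Q1' \<Rightarrow> Q1'" is "(+)"
  by (drule (1) tensor_add) (simp add: algebra_simps)
lift_definition uminus_Q1' :: "Q1' \<Rightarrow> Q1'" is uminus
  by (drule tensor_uminus) (simp add: algebra_simps)
lift_definition minus_Q1' :: "Q1' \<Rightarrow> Q1' \<Rightarrow> Q1'" is "(-)"
  by (drule (1) tensor_diff) (simp add: algebra_simps)

instance
proof
  fix a b c :: Q1'
  show "a + b + c = a + (b + c)" by transfer (rule tensor_eqI, simp add: algebra_simps)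
  show "a + b = b + a" by transfer (rule tensor_eqI, simp add: algebra_simps)
  show "0 + a = a" by transfer (rule tensor_eqI, simp)
  show "- a + a = 0" by transfer (rule tensor_eqI, simp)
  show "a - b = a + - b" by transfer (rule tensor_eqI, simp)
qed

end

lemma Q1'_act_add_left: "(p + q) \<cdot> u = p \<cdot> u + q \<cdot> u"
  by transfer (rule tensor_eqI, simp add: frag_act_def frag_extend_add)

lemma Q1'_act_zero_left: "0 \<cdot> u = 0"
  using Q1'_act_add_left[of 0 0 u] by simp

lemma Q1'_act_uminus_left: "(- p) \<cdot> u = - (p \<cdot> u)"
  using Q1'_act_add_left[of "- p" p u] by (simp add: Q1'_act_zero_left eq_neg_iff_add_eq_0)

lemma Q1'_act_diff_left: "(p - q) \<cdot> u = p \<cdot> u - q \<cdot> u"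
  using Q1'_act_add_left[of p "- q" u] by (simp add: Q1'_act_uminus_left)

lemma Q1'_act_mult: "p \<cdot> u \<cdot> v = p \<cdot> (u * v)"
proof (transfer, rule tensor_eqI)
  fix p :: "complex \<times> witt uea \<Rightarrow>\<^sub>0 int" and u v :: "witt uea"
  show "frag_act (frag_act p u) v = frag_act p (u * v)"
    unfolding frag_act_def
    by (rule frag_induction[of p UNIV])
      (auto simp: frag_extend_diff mult.assoc split: prod.splits)
qed

lemma Q1'_act_one: "p \<cdot> 1 = p"
proof (transfer, rule tensor_eqI)
  fix p :: "complex \<times> witt uea \<Rightarrow>\<^sub>0 int"
  show "frag_act p 1 = p"
    unfolding frag_act_def
    by (rule frag_induction[of p UNIV]) (auto simp: frag_extend_diff split: prod.splits)
qed

lemma Q1'_act_add_right: "p \<cdot> (u + v) = p \<cdot> u + p \<cdot> v"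
proof transfer
  fix p :: "complex \<times> witt uea \<Rightarrow>\<^sub>0 int" and u v :: "witt uea"
  show "frag_act p (u + v) - (frag_act p u + frag_act p v) \<in> tensor_relations N1_act UW_left_act"
  proof (rule frag_induction[of p UNIV])
    fix a b :: "complex \<times> witt uea \<Rightarrow>\<^sub>0 int"
    assume "frag_act a (u + v) - (frag_act a u + frag_act a v) \<in> tensor_relations N1_act UW_left_act"
      "frag_act b (u + v) - (frag_act b u + frag_act b v) \<in> tensor_relations N1_act UW_left_act"
    from tensor_diff[OF this]
    show "frag_act (a - b) (u + v) - (frag_act (a - b) u + frag_act (a - b) v)
        \<in> tensor_relations N1_act UW_left_act"
      by (simp add: frag_act_def frag_extend_diff algebra_simps)
  next
    fix x :: "complex \<times> witt uea"
    show "frag_act (frag_of x) (u + v) - (frag_act (frag_of x) u + frag_act (frag_of x) v)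
        \<in> tensor_relations N1_act UW_left_act"
      using tensor_add_right[of "fst x" "snd x * u" "snd x * v"]
      by (cases x) (simp add: frag_act_def distrib_left diff_diff_eq)
  qed (simp_all add: frag_act_def tensor_zero)
qed

instantiation Q1' :: complex_vector
begin

definition scaleC_Q1' :: "complex \<Rightarrow> Q1' \<Rightarrow> Q1'" where
  "c *\<^sub>C q = q \<cdot> (c *\<^sub>C 1)"

instance
  by standard (simp_all add: scaleC_Q1'_def Q1'_act_add_left Q1'_act_add_right Q1'_act_mult
      Q1'_act_one scaleC_add_left scaleC_one mult_scaleC_left scaleC_scaleC mult.commute)

end

lemma Q1'_act_scaleC: "(c *\<^sub>C q) \<cdot> u = c *\<^sub>C (q \<cdot> u)"
  by (simp add: scaleC_Q1'_def Q1'_act_mult mult_scaleC_left mult_scaleC_right)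


section \<open>The endomorphism algebra \<open>H\<^sub>1'\<close>\<close>

typedef H1' = "{f :: Q1' \<Rightarrow> Q1'. (\<forall>p q. f (p + q) = f p + f q) \<and> (\<forall>q u. f (q \<cdot> u) = f q \<cdot> u)}"
  by (rule exI[of _ id]) simp

setup_lifting type_definition_H1'

instantiation H1' :: complex_algebra
begin

lift_definition zero_H1' :: H1' is "\<lambda>_. 0"
  by (simp add: Q1'_act_zero_left)
lift_definition one_H1' :: H1' is id by simp
lift_definition plus_H1' :: "H1' \<Rightarrow> H1' \<Rightarrow> H1'" is "\<lambda>f g q. f q + g q"
  by (auto simp: Q1'_act_add_left algebra_simps)
lift_definition scaleC_H1' :: "complex \<Rightarrow> H1' \<Rightarrow> H1'" is "\<lambda>c f q. c *\<^sub>C f q"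
  by (auto simp: Q1'_act_scaleC scaleC_add_right)
lift_definition uminus_H1' :: "H1' \<Rightarrow> H1'" is "\<lambda>f q. - f q"
  by (simp add: Q1'_act_uminus_left)
lift_definition minus_H1' :: "H1' \<Rightarrow> H1' \<Rightarrow> H1'" is "\<lambda>f g q. f q - g q"
  by (simp add: Q1'_act_diff_left)
lift_definition times_H1' :: "H1' \<Rightarrow> H1' \<Rightarrow> H1'" is "(\<circ>)" by simp

lemma Rep_H1'_linear:
  "Rep_H1' f (p + q) = Rep_H1' f p + Rep_H1' f q" "Rep_H1' f (c *\<^sub>C q) = c *\<^sub>C Rep_H1' f q"
  using Rep_H1'[of f] by (simp_all add: scaleC_Q1'_def)

instance
proof
  fix a b c :: H1' and r s :: complex
  show "a + b + c = a + (b + c)" by transfer (simp add: algebra_simps)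
  show "a + b = b + a" by transfer (simp add: algebra_simps)
  show "0 + a = a" by transfer simp
  show "- a + a = 0" by transfer simp
  show "a - b = a + - b" by transfer simp
  show "a * b * c = a * (b * c)" by transfer (simp add: comp_assoc)
  show "(a + b) * c = a * c + b * c" by transfer (simp add: fun_eq_iff)
  show "a * (b + c) = a * b + a * c" by transfer (simp add: fun_eq_iff)
  show "1 * a = a" by transfer simp
  show "a * 1 = a" by transfer simp
  show "r *\<^sub>C (a + b) = r *\<^sub>C a + r *\<^sub>C b" by transfer (simp add: scaleC_add_right)
  show "(r + s) *\<^sub>C a = r *\<^sub>C a + s *\<^sub>C a" by transfer (simp add: scaleC_add_left)
  show "r *\<^sub>C (s *\<^sub>C a) = (r * s) *\<^sub>C a" by transfer (simp add: scaleC_scaleC)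
  show "1 *\<^sub>C a = a" by transfer (simp add: scaleC_one)
  show "(r *\<^sub>C a) * b = r *\<^sub>C (a * b)" by transfer (simp add: fun_eq_iff)
  show "a * (r *\<^sub>C b) = r *\<^sub>C (a * b)"
    by (rule iffD1[OF Rep_H1'_inject], rule ext)
      (simp add: times_H1'.rep_eq scaleC_H1'.rep_eq Rep_H1'_linear)
qed

end

lifting_update uea.lifting
lifting_update witt.lifting

end

theory Submission
  imports Defs "HOL-Library.Product_Plus"
begin

text \<open>Write \<open>J = (d\<^sub>-\<^sub>1 - 1) U(\<WW>)\<close>. The module \<open>Q\<^sub>1'\<close> is \<open>U(\<WW>) / J\<close>, generated by \<open>1 \<otimes> 1\<close>, so an
  endomorphism is determined by the image \<open>1 \<otimes> m\<close> of the generator, and a class \<open>1 \<otimes> m\<close> is such an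
  image exactly when \<open>m (d\<^sub>-\<^sub>1 - 1) \<in> J\<close>. Since \<open>U(\<WW>) = U(\<bb>) \<oplus> J\<close>, each class has exactly one
  representative \<open>m\<close> in \<open>U(\<bb>)\<close>, and the condition on it is membership in \<open>H\<^sub>1\<close>. The isomorphism
  sends \<open>u \<in> H\<^sub>1\<close> to left multiplication \<open>1 \<otimes> m \<mapsto> 1 \<otimes> u m\<close>.

  The point that needs an argument is that the sum is direct and that \<open>U(\<bb>) \<rightarrow> U(\<WW>)\<close> is
  injective. Instead of the Poincare-Birkhoff-Witt theorem, the proof makes \<open>U(\<bb>)\<close> itself a right
  \<open>U(\<WW>)\<close>-module in which \<open>\<bb>\<close> acts by right multiplication and \<open>1 \<cdot> d\<^sub>-\<^sub>1 = 1\<close>. Acting on \<open>1\<close> then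
  kills \<open>J\<close> (\<open>witt_act_ideal\<close>) and sends \<open>u \<in> U(\<bb>)\<close> to \<open>u\<close> (\<open>witt_act_borel_incl\<close>), so it is the
  projection of \<open>U(\<WW>)\<close> onto \<open>U(\<bb>)\<close> along \<open>J\<close>.

  The operator \<open>T\<close> by which \<open>d\<^sub>-\<^sub>1\<close> must act is forced by commuting \<open>d\<^sub>-\<^sub>1\<close> to the left: for
  \<open>y \<in> \<bb>\<close> with \<open>[y, d\<^sub>-\<^sub>1] = \<lambda>(y) d\<^sub>-\<^sub>1 + \<delta>(y)\<close>, \<open>\<delta>(y) \<in> \<bb>\<close>, it satisfies \<open>T(1) = 1\<close> and
  \<open>T(u y) = T(u) y + \<lambda>(y) T(u) + u \<delta>(y)\<close>. That these equations are consistent with the relations of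
  \<open>U(\<bb>)\<close> is seen by letting \<open>\<bb>\<close> act on pairs \<open>(u, T(u))\<close>, that is, by checking that
  \<open>(u, t) \<mapsto> (u y, t y + \<lambda>(y) t + u \<delta>(y))\<close> is a representation of \<open>\<bb>\<close> on \<open>U(\<bb>) \<times> U(\<bb>)\<close>.\<close>

section \<open>Modules over a universal enveloping algebra\<close>

instantiation prod :: (complex_vector, complex_vector) complex_vector
begin

definition scaleC_prod :: "complex \<Rightarrow> 'a \<times> 'b \<Rightarrow> 'a \<times> 'b" where
  "scaleC_prod c p = (c *\<^sub>C fst p, c *\<^sub>C snd p)"

instance
  by standard
    (simp_all add: scaleC_prod_def prod_eq_iff scaleC_add_right scaleC_add_left scaleC_scaleC
      scaleC_one)

end

lemma uea_abs_cases:
  fixes u :: "'a::lie_algebra uea"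
  obtains p where "u = abs_uea p"
  by (rule that[of "rep_uea u"]) (simp add: Quotient3_abs_rep[OF Quotient3_uea])

lemma uea_induct [case_names one gen add scaleC]:
  fixes u :: "'a::lie_algebra uea"
  assumes one: "P 1" and gen: "\<And>u x. P u \<Longrightarrow> P (u * uea_gen x)"
    and add: "\<And>u v. P u \<Longrightarrow> P v \<Longrightarrow> P (u + v)" and scaleC: "\<And>c u. P u \<Longrightarrow> P (c *\<^sub>C u)"
  shows "P u"
proof -
  have "P (abs_uea p)" for p :: "'a list \<Rightarrow>\<^sub>0 complex"
  proof (induction p rule: free_algebra_induct)
    case (single w c)
    have "P (abs_uea (word w))"
    proof (induction w rule: rev_induct)
      case Nil
      then show ?case using one by (simp add: word_Nil flip: one_uea.abs_eq)
    next
      case (snoc x w)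
      have "word (w @ [x]) = word w * word [x]" by (simp add: mult_single plus_list_def)
      then have "abs_uea (word (w @ [x])) = abs_uea (word w) * uea_gen x"
        by (simp add: times_uea.abs_eq uea_gen.abs_eq)
      then show ?case using gen[OF snoc] by simp
    qed
    moreover have "abs_uea (Poly_Mapping.single w c) = c *\<^sub>C abs_uea (word w)"
      by (simp add: scaleC_uea.abs_eq mult_single plus_list_def)
    ultimately show ?case using scaleC by simp
  next
    case (add p q)
    then show ?case using assms(3) by (simp flip: plus_uea.abs_eq)
  qed
  then show ?thesis by (cases u rule: uea_abs_cases) simp
qed

text \<open>The action of the free algebra through which a right action of a Lie algebra extends to its
  enveloping algebra. It is the counterpart of \<^const>\<open>free_eval\<close> for a module in place of an algebra;
  letters act from left to right, as befits a right module.\<close>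

definition free_act :: "('v::complex_vector \<Rightarrow> 'a \<Rightarrow> 'v) \<Rightarrow> 'v \<Rightarrow> ('a list \<Rightarrow>\<^sub>0 complex) \<Rightarrow> 'v" where
  "free_act r v p =
     (\<Sum>w\<in>Poly_Mapping.keys p. Poly_Mapping.lookup p w *\<^sub>C foldl r v w)"

lemma free_act_superset:
  assumes "finite A" "Poly_Mapping.keys p \<subseteq> A"
  shows "free_act r v p = (\<Sum>w\<in>A. Poly_Mapping.lookup p w *\<^sub>C foldl r v w)"
  unfolding free_act_def using assms
  by (intro sum.mono_neutral_left) (auto simp: in_keys_iff)

lemma free_act_single: "free_act r v (Poly_Mapping.single w c) = c *\<^sub>C foldl r v w"
  by (subst free_act_superset[of "{w}"]) auto

lemma free_act_zero_right: "free_act r v 0 = 0"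
  by (simp add: free_act_def)

lemma free_act_add_right: "free_act r v (p + q) = free_act r v p + free_act r v q"
proof -
  let ?A = "Poly_Mapping.keys p \<union> Poly_Mapping.keys q"
  have "free_act r v (p + q) = (\<Sum>w\<in>?A. Poly_Mapping.lookup (p + q) w *\<^sub>C foldl r v w)"
    by (rule free_act_superset) (use Poly_Mapping.keys_add[of p q] in auto)
  moreover have "free_act r v p = (\<Sum>w\<in>?A. Poly_Mapping.lookup p w *\<^sub>C foldl r v w)"
    "free_act r v q = (\<Sum>w\<in>?A. Poly_Mapping.lookup q w *\<^sub>C foldl r v w)"
    by (rule free_act_superset; auto)+
  ultimately show ?thesis
    by (simp add: lookup_add scaleC_add_left sum.distrib)
qed

lemma free_act_diff_right: "free_act r v (p - q) = free_act r v p - free_act r v q"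
  using free_act_add_right[of r v "p - q" q] by simp

text \<open>The sign of the bracket axiom is that of a right action: \<open>v [x, y] = (v x) y - (v y) x\<close>.\<close>

locale lie_right_module =
  fixes act :: "'v::complex_vector \<Rightarrow> 'a::lie_algebra \<Rightarrow> 'v"
  assumes act_add_left: "act (v + w) x = act v x + act w x"
    and act_scaleC_left: "act (c *\<^sub>C v) x = c *\<^sub>C act v x"
    and act_add_right: "act v (x + y) = act v x + act v y"
    and act_scaleC_right: "act v (c *\<^sub>C x) = c *\<^sub>C act v x"
    and act_bracket: "act v (lie_bracket x y) = act (act v x) y - act (act v y) x"
begin

definition uea_act :: "'v \<Rightarrow> 'a uea \<Rightarrow> 'v" where
  "uea_act v u = free_act act v (rep_uea u)"

lemma foldl_act_add: "foldl act (v + w) xs = foldl act v xs + foldl act w xs"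
  by (induction xs arbitrary: v w) (simp_all add: act_add_left)

lemma foldl_act_scaleC: "foldl act (c *\<^sub>C v) xs = c *\<^sub>C foldl act v xs"
  by (induction xs arbitrary: v) (simp_all add: act_scaleC_left)

lemma free_act_add_left: "free_act act (v + w) p = free_act act v p + free_act act w p"
  by (simp add: free_act_def foldl_act_add scaleC_add_right sum.distrib)

lemma free_act_scaleC_left: "free_act act (c *\<^sub>C v) p = c *\<^sub>C free_act act v p"
  by (simp add: free_act_def foldl_act_scaleC complex_vector.scale_sum_right scaleC_scaleC mult.commute)

lemma free_act_zero_left: "free_act act 0 p = 0"
  using free_act_add_left[of 0 0 p] by simp

lemma free_act_mult: "free_act act v (p * q) = free_act act (free_act act v p) q"
proof (induction p rule: free_algebra_induct)
  case (single xs a)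
  show ?case
    by (induction q rule: free_algebra_induct)
      (simp_all add: mult_single plus_list_def free_act_single foldl_act_scaleC scaleC_scaleC
        free_act_add_right distrib_left mult.commute)
qed (simp add: free_act_add_right free_act_add_left distrib_right)

text \<open>The induction must range over all vectors, because in a product \<open>r * p\<close> the ideal element
  \<open>p\<close> acts on a vector already moved by \<open>r\<close>.\<close>

lemma free_act_ideal:
  assumes "p \<in> two_sided_ideal uea_relations"
  shows "free_act act v p = 0"
  using assms
proof (induction arbitrary: v)
  case (ideal_gen s)
  then show ?case
    unfolding uea_relations_def
    by (auto simp: free_act_diff_right free_act_single scaleC_one act_add_right
        act_scaleC_right act_bracket)
qed (simp_all add: free_act_zero_right free_act_zero_left free_act_add_right free_act_mult)

lemma uea_act_abs: "uea_act v (abs_uea p) = free_act act v p"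
proof -
  have "rep_uea (abs_uea p) - p \<in> two_sided_ideal uea_relations"
    unfolding uea.abs_eq_iff[symmetric] by (rule Quotient3_abs_rep[OF Quotient3_uea])
  then show ?thesis
    using free_act_ideal[of "rep_uea (abs_uea p) - p" v]
    by (simp add: uea_act_def free_act_diff_right)
qed

lemma uea_act_add_left: "uea_act (v + w) u = uea_act v u + uea_act w u"
  by (simp add: uea_act_def free_act_add_left)

lemma uea_act_scaleC_left: "uea_act (c *\<^sub>C v) u = c *\<^sub>C uea_act v u"
  by (simp add: uea_act_def free_act_scaleC_left)

lemma uea_act_zero_left: "uea_act 0 u = 0"
  by (simp add: uea_act_def free_act_zero_left)

lemma uea_act_mult: "uea_act v (u * u') = uea_act (uea_act v u) u'"
  by (cases u rule: uea_abs_cases; cases u' rule: uea_abs_cases)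
    (simp add: uea_act_abs times_uea.abs_eq free_act_mult)

lemma uea_act_add_right: "uea_act v (u + u') = uea_act v u + uea_act v u'"
  by (cases u rule: uea_abs_cases; cases u' rule: uea_abs_cases)
    (simp add: uea_act_abs plus_uea.abs_eq free_act_add_right)

lemma uea_act_diff_right: "uea_act v (u - u') = uea_act v u - uea_act v u'"
  using uea_act_add_right[of v "u - u'" u'] by simp

lemma uea_act_gen: "uea_act v (uea_gen x) = act v x"
  by (simp add: uea_gen.abs_eq uea_act_abs free_act_single scaleC_one)

lemma uea_act_one: "uea_act v 1 = v"
  by (simp add: one_uea_def uea_act_abs free_act_single scaleC_one flip: word_Nil)

lemma uea_act_scaleC_right: "uea_act v (c *\<^sub>C u) = c *\<^sub>C uea_act v u"
  by (cases u rule: uea_abs_cases)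
    (simp add: uea_act_abs scaleC_uea.abs_eq free_act_mult free_act_single free_act_scaleC_left)

lemma uea_act_sum_right: "uea_act v (\<Sum>i\<in>A. f i) = (\<Sum>i\<in>A. uea_act v (f i))"
proof (induction A rule: infinite_finite_induct)
  case (insert i A)
  then show ?case by (simp add: uea_act_add_right)
qed (use uea_act_diff_right[of v 0 0] in simp_all)

end


section \<open>The decomposition of \<open>\<WW>\<close> as \<open>\<complex> d\<^sub>-\<^sub>1 \<oplus> \<bb>\<close>\<close>

text \<open>The coefficient of \<open>d\<^sub>-\<^sub>1\<close>: the derivation \<open>f(x) \<partial>/\<partial>x\<close> sends \<open>x\<close> to \<open>f(x)\<close>, and \<open>f(0)\<close> is the
  component outside \<open>\<bb>\<close>.\<close>

definition witt_lead :: "witt \<Rightarrow> complex" where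
  "witt_lead D = coeff (Rep_witt D [:0, 1:]) 0"

definition borel_part :: "witt \<Rightarrow> borel" where
  "borel_part D = Abs_borel (D - witt_lead D *\<^sub>C d (-1))"

lemma witt_lead_add: "witt_lead (D + E) = witt_lead D + witt_lead E"
  by (simp add: witt_lead_def plus_witt.rep_eq)

lemma witt_lead_scaleC: "witt_lead (c *\<^sub>C D) = c * witt_lead D"
  by (simp add: witt_lead_def scaleC_witt.rep_eq)

lemma witt_lead_zero: "witt_lead 0 = 0"
  by (simp add: witt_lead_def zero_witt.rep_eq)

lemma witt_lead_d: "witt_lead (d i) = (if i \<le> -1 then 1 else 0)"
  by (auto simp: witt_lead_def d.rep_eq pderiv_pCons coeff_monom)

lemma witt_lead_Rep_borel: "witt_lead (Rep_borel y) = 0"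
proof -
  have "Rep_borel y \<in> cspan {d i | i. i \<ge> 0}" by (rule Rep_borel)
  then show ?thesis
    by (induction rule: complex_vector.span_induct_alt)
      (auto simp: witt_lead_zero witt_lead_add witt_lead_scaleC witt_lead_d)
qed

text \<open>A derivation of \<open>\<complex>[x]\<close> is determined by its value at \<open>x\<close>, by the Leibniz rule.\<close>

lemma Rep_witt_eq: "Rep_witt D p = Rep_witt D [:0, 1:] * pderiv p"
proof -
  have D: "Rep_witt D (p + q) = Rep_witt D p + Rep_witt D q"
    "Rep_witt D (smult c p) = smult c (Rep_witt D p)"
    "Rep_witt D (p * q) = Rep_witt D p * q + p * Rep_witt D q" for p q c
    using Rep_witt[of D] by blast+
  have one: "Rep_witt D 1 = 0" using D(3)[of 1 1] by simp
  show ?thesis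
  proof (induction p)
    case 0
    then show ?case using D(2)[of 0 0] by simp
  next
    case (pCons a p)
    have "pCons a p = smult a 1 + [:0, 1:] * p" by simp
    then have "Rep_witt D (pCons a p) = Rep_witt D (smult a 1 + [:0, 1:] * p)" by simp
    also have "\<dots> = Rep_witt D [:0, 1:] * p + [:0, 1:] * Rep_witt D p"
      unfolding D one by simp
    finally show ?case using pCons by (simp add: pderiv_pCons algebra_simps)
  qed
qed

lemma witt_eqI: "Rep_witt D [:0, 1:] = Rep_witt E [:0, 1:] \<Longrightarrow> D = E"
  by (metis Rep_witt_eq Rep_witt_inject ext)

lemma witt_sum_d: "D = (\<Sum>i\<le>degree (Rep_witt D [:0, 1:]). coeff (Rep_witt D [:0, 1:]) i *\<^sub>C d (int i - 1))"
proof (rule witt_eqI)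
  let ?q = "Rep_witt D [:0, 1:]"
  have s: "Rep_witt (\<Sum>i\<in>A. f i) p = (\<Sum>i\<in>A. Rep_witt (f i) p)" if "finite A"
    for A :: "nat set" and f :: "nat \<Rightarrow> witt" and p
    using that by induction (simp_all add: zero_witt.rep_eq plus_witt.rep_eq)
  show "?q = Rep_witt (\<Sum>i\<le>degree ?q. coeff ?q i *\<^sub>C d (int i - 1)) [:0, 1:]"
    by (simp add: s scaleC_witt.rep_eq d.rep_eq pderiv_pCons smult_monom poly_as_sum_of_monoms)
qed

lemma witt_minus_lead_in_borel: "D - witt_lead D *\<^sub>C d (-1) \<in> cspan {d i | i. i \<ge> 0}"
proof -
  let ?q = "Rep_witt D [:0, 1:]"
  have "D = (\<Sum>i\<in>{0..degree ?q}. coeff ?q i *\<^sub>C d (int i - 1))"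
    using witt_sum_d[of D] unfolding atMost_atLeast0 .
  also have "\<dots> = coeff ?q 0 *\<^sub>C d (-1) + (\<Sum>i\<in>{0<..degree ?q}. coeff ?q i *\<^sub>C d (int i - 1))"
    by (subst sum.head) simp_all
  also have "\<dots> = (\<Sum>i\<in>{0<..degree ?q}. coeff ?q i *\<^sub>C d (int i - 1)) + coeff ?q 0 *\<^sub>C d (-1)"
    by (rule add.commute)
  finally have "D - witt_lead D *\<^sub>C d (-1) = (\<Sum>i\<in>{0<..degree ?q}. coeff ?q i *\<^sub>C d (int i - 1))"
    unfolding witt_lead_def diff_eq_eq .
  also have "\<dots> \<in> cspan {d i | i. i \<ge> 0}"
  proof (intro complex_vector.span_sum complex_vector.span_scale complex_vector.span_base)
    fix i assume "i \<in> {0<..degree ?q}"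
    then show "d (int i - 1) \<in> {d i | i. i \<ge> 0}" by (intro CollectI exI[of _ "int i - 1"]) auto
  qed
  finally show ?thesis .
qed

lemma Rep_borel_part: "Rep_borel (borel_part D) = D - witt_lead D *\<^sub>C d (-1)"
  by (simp add: borel_part_def Abs_borel_inverse witt_minus_lead_in_borel)

lemma witt_decomp: "D = witt_lead D *\<^sub>C d (-1) + Rep_borel (borel_part D)"
  by (simp add: Rep_borel_part)

lemma borel_part_add: "borel_part (D + E) = borel_part D + borel_part E"
  by (simp add: Rep_borel_inject[symmetric] plus_borel.rep_eq Rep_borel_part witt_lead_add
      scaleC_add_left algebra_simps)

lemma borel_part_scaleC: "borel_part (c *\<^sub>C D) = c *\<^sub>C borel_part D"
  by (simp add: Rep_borel_inject[symmetric] scaleC_borel.rep_eq Rep_borel_part witt_lead_scaleC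
      complex_vector.scale_right_diff_distrib)

lemma borel_part_Rep_borel: "borel_part (Rep_borel y) = y"
  by (simp add: Rep_borel_inject[symmetric] Rep_borel_part witt_lead_Rep_borel)


section \<open>\<open>U(\<bb>)\<close> as a right \<open>U(\<WW>)\<close>-module\<close>

text \<open>These are the maps \<open>\<lambda>\<close> and \<open>\<delta>\<close> in \<open>[y, d\<^sub>-\<^sub>1] = \<lambda>(y) d\<^sub>-\<^sub>1 + \<delta>(y)\<close>.\<close>

definition ad_lead :: "borel \<Rightarrow> complex" where
  "ad_lead y = witt_lead (lie_bracket (Rep_borel y) (d (-1)))"

definition ad_borel :: "borel \<Rightarrow> borel" where
  "ad_borel y = borel_part (lie_bracket (Rep_borel y) (d (-1)))"

lemma bracket_d_minus_1:
  "lie_bracket (Rep_borel y) (d (-1)) = ad_lead y *\<^sub>C d (-1) + Rep_borel (ad_borel y)"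
  unfolding ad_lead_def ad_borel_def by (rule witt_decomp)

lemma ad_lead_add: "ad_lead (y + z) = ad_lead y + ad_lead z"
  by (simp add: ad_lead_def plus_borel.rep_eq lie_add_left witt_lead_add)

lemma ad_lead_scaleC: "ad_lead (c *\<^sub>C y) = c * ad_lead y"
  by (simp add: ad_lead_def scaleC_borel.rep_eq lie_scaleC_left witt_lead_scaleC)

lemma ad_borel_add: "ad_borel (y + z) = ad_borel y + ad_borel z"
  by (simp add: ad_borel_def plus_borel.rep_eq lie_add_left borel_part_add)

lemma ad_borel_scaleC: "ad_borel (c *\<^sub>C y) = c *\<^sub>C ad_borel y"
  by (simp add: ad_borel_def scaleC_borel.rep_eq lie_scaleC_left borel_part_scaleC)

lemma lie_bracket_antisym: "lie_bracket x y = - lie_bracket y x" for x :: "'a::lie_algebra"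
proof -
  have "lie_bracket (x + y) (x + y) = lie_bracket x y + lie_bracket y x"
    unfolding lie_add_left lie_add_right by (simp add: lie_self)
  then show ?thesis by (simp add: lie_self eq_neg_iff_add_eq_0)
qed

lemma lie_bracket_uminus_right: "lie_bracket x (- y) = - lie_bracket x y" for x :: "'a::lie_algebra"
  using lie_add_right[of x y "- y"] by (simp add: lie_bracket_zero add_eq_0_iff)

text \<open>Expand \<open>[[y, z], d\<^sub>-\<^sub>1] = [y, [z, d\<^sub>-\<^sub>1]] - [z, [y, d\<^sub>-\<^sub>1]]\<close>: the two multiples of \<open>d\<^sub>-\<^sub>1\<close>
  have the same coefficient \<open>\<lambda>(y) \<lambda>(z)\<close> and cancel, so that \<open>\<lambda>\<close> is a character of \<open>\<bb>\<close> and \<open>\<delta>\<close> is a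
  derivation twisted by \<open>\<lambda>\<close>.\<close>

lemma bracket_bracket_d_minus_1:
  "lie_bracket (Rep_borel (lie_bracket y z)) (d (-1)) =
     Rep_borel (ad_lead z *\<^sub>C ad_borel y - ad_lead y *\<^sub>C ad_borel z
       + lie_bracket y (ad_borel z) - lie_bracket z (ad_borel y))"
proof -
  let ?y = "Rep_borel y" and ?z = "Rep_borel z" and ?d = "d (-1)"
  have "lie_bracket (lie_bracket ?y ?z) ?d
      = lie_bracket ?y (lie_bracket ?z ?d) - lie_bracket ?z (lie_bracket ?y ?d)"
    using lie_jacobi[of ?y ?z ?d] lie_bracket_antisym[of ?d "lie_bracket ?y ?z"]
      lie_bracket_antisym[of ?d ?y]
    by (simp add: lie_bracket_uminus_right algebra_simps)
  also have "\<dots> = ad_lead z *\<^sub>C Rep_borel (ad_borel y) - ad_lead y *\<^sub>C Rep_borel (ad_borel z)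
       + lie_bracket ?y (Rep_borel (ad_borel z)) - lie_bracket ?z (Rep_borel (ad_borel y))"
    unfolding bracket_d_minus_1 lie_add_right lie_scaleC_right
    by (simp add: scaleC_add_right scaleC_scaleC mult.commute)
  finally show ?thesis
    by (simp add: plus_borel.rep_eq minus_borel.rep_eq scaleC_borel.rep_eq lie_bracket_borel.rep_eq)
qed

lemma ad_lead_bracket: "ad_lead (lie_bracket y z) = 0"
  unfolding ad_lead_def bracket_bracket_d_minus_1 by (rule witt_lead_Rep_borel)

lemma ad_borel_bracket:
  "ad_borel (lie_bracket y z) = ad_lead z *\<^sub>C ad_borel y - ad_lead y *\<^sub>C ad_borel z
     + lie_bracket y (ad_borel z) - lie_bracket z (ad_borel y)"
  unfolding ad_borel_def[of "lie_bracket y z"] bracket_bracket_d_minus_1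
  by (rule borel_part_Rep_borel)

lemma uea_gen_diff: "uea_gen (x - y) = uea_gen x - uea_gen y"
  using uea_gen_add[of "x - y" y] by simp

text \<open>A triangular action, whose second component is the recursion that commuting \<open>d\<^sub>-\<^sub>1\<close> past \<open>y\<close>
  imposes on the action of \<open>d\<^sub>-\<^sub>1\<close>. The identities for \<open>\<lambda>([y, z])\<close> and \<open>\<delta>([y, z])\<close> say exactly that it
  respects brackets.\<close>

definition pair_act :: "borel uea \<times> borel uea \<Rightarrow> borel \<Rightarrow> borel uea \<times> borel uea" where
  "pair_act p y = (fst p * uea_gen y,
     snd p * uea_gen y + ad_lead y *\<^sub>C snd p + fst p * uea_gen (ad_borel y))"

interpretation pair: lie_right_module pair_act
proof
  fix p q :: "borel uea \<times> borel uea" and y z :: borel and c :: complex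
  show "pair_act (p + q) y = pair_act p y + pair_act q y"
    by (simp add: pair_act_def prod_eq_iff distrib_right scaleC_add_right add_ac)
  show "pair_act (c *\<^sub>C p) y = c *\<^sub>C pair_act p y"
    by (simp add: pair_act_def scaleC_prod_def mult_scaleC_left scaleC_add_right scaleC_scaleC mult.commute)
  show "pair_act p (y + z) = pair_act p y + pair_act p z"
    by (simp add: pair_act_def prod_eq_iff distrib_left scaleC_add_left ad_lead_add ad_borel_add
        uea_gen_add add_ac)
  show "pair_act p (c *\<^sub>C y) = c *\<^sub>C pair_act p y"
    by (simp add: pair_act_def scaleC_prod_def mult_scaleC_right scaleC_add_right scaleC_scaleC
        ad_lead_scaleC ad_borel_scaleC uea_gen_scaleC)
  show "pair_act p (lie_bracket y z) = pair_act (pair_act p y) z - pair_act (pair_act p z) y"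
    by (simp add: pair_act_def prod_eq_iff ad_lead_bracket ad_borel_bracket uea_gen_add uea_gen_diff
        uea_gen_scaleC mult_scaleC_left mult_scaleC_right scaleC_add_right scaleC_scaleC mult.commute
        complex_vector.scale_zero_left algebra_simps flip: uea_gen_bracket)
qed

text \<open>Starting at \<open>(1, 1)\<close> encodes \<open>1 \<cdot> d\<^sub>-\<^sub>1 = 1\<close>; after acting by \<open>u\<close> the first component is \<open>u\<close>, so the
  second is a well-defined function of \<open>u\<close>.\<close>

definition act_d_minus_1 :: "borel uea \<Rightarrow> borel uea" where
  "act_d_minus_1 u = snd (pair.uea_act (1, 1) u)"

lemma fst_pair_act: "fst (pair_act p y) = fst p * uea_gen y"
  by (simp add: pair_act_def)

lemma fst_pair_uea_act: "fst (pair.uea_act (1, 1) u) = u"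
  by (induction u rule: uea_induct)
    (simp_all add: pair.uea_act_one pair.uea_act_mult pair.uea_act_gen pair.uea_act_add_right
      pair.uea_act_scaleC_right scaleC_prod_def fst_pair_act)

lemma act_d_minus_1_one: "act_d_minus_1 1 = 1"
  by (simp add: act_d_minus_1_def pair.uea_act_one)

lemma act_d_minus_1_add: "act_d_minus_1 (u + v) = act_d_minus_1 u + act_d_minus_1 v"
  by (simp add: act_d_minus_1_def pair.uea_act_add_right)

lemma act_d_minus_1_scaleC: "act_d_minus_1 (c *\<^sub>C u) = c *\<^sub>C act_d_minus_1 u"
  by (simp add: act_d_minus_1_def pair.uea_act_scaleC_right scaleC_prod_def)

lemma act_d_minus_1_mult_gen:
  "act_d_minus_1 (u * uea_gen y) = act_d_minus_1 u * uea_gen y + ad_lead y *\<^sub>C act_d_minus_1 u + u * uea_gen (ad_borel y)"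
  by (simp add: act_d_minus_1_def pair.uea_act_mult pair.uea_act_gen pair_act_def fst_pair_uea_act)

text \<open>The right action of \<open>\<WW>\<close> on \<open>U(\<bb>)\<close>. It respects brackets of two elements of \<open>\<bb>\<close> by the
  relations of \<open>U(\<bb>)\<close>, and brackets of an element of \<open>\<bb>\<close> with \<open>d\<^sub>-\<^sub>1\<close> by \<open>act_d_minus_1_mult_gen\<close>.\<close>

definition witt_act :: "borel uea \<Rightarrow> witt \<Rightarrow> borel uea" where
  "witt_act u D = witt_lead D *\<^sub>C act_d_minus_1 u + u * uea_gen (borel_part D)"

lemma bracket_decomp:
  "lie_bracket D E = (witt_lead E * ad_lead (borel_part D) - witt_lead D * ad_lead (borel_part E)) *\<^sub>C d (-1)
     + Rep_borel (witt_lead E *\<^sub>C ad_borel (borel_part D) - witt_lead D *\<^sub>C ad_borel (borel_part E)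
         + lie_bracket (borel_part D) (borel_part E))"
proof -
  have "lie_bracket D E = lie_bracket (witt_lead D *\<^sub>C d (-1) + Rep_borel (borel_part D))
      (witt_lead E *\<^sub>C d (-1) + Rep_borel (borel_part E))"
    by (metis witt_decomp)
  then show ?thesis
    using lie_bracket_antisym[of "d (-1)" "Rep_borel (borel_part E)"]
    by (simp add: lie_add_left lie_add_right lie_scaleC_left lie_scaleC_right bracket_d_minus_1 lie_self
        plus_borel.rep_eq minus_borel.rep_eq scaleC_borel.rep_eq lie_bracket_borel.rep_eq
        scaleC_add_right scaleC_scaleC complex_vector.scale_left_diff_distrib
        complex_vector.scale_minus_right algebra_simps)
qed

lemma witt_lead_d_plus_borel: "witt_lead (a *\<^sub>C d (-1) + Rep_borel y) = a"
  by (simp add: witt_lead_add witt_lead_scaleC witt_lead_d witt_lead_Rep_borel)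

lemma borel_part_d_plus_borel: "borel_part (a *\<^sub>C d (-1) + Rep_borel y) = y"
  by (simp add: Rep_borel_inject[symmetric] Rep_borel_part witt_lead_d_plus_borel)

interpretation witt: lie_right_module witt_act
proof
  fix u v :: "borel uea" and D E :: witt and c :: complex
  show "witt_act (u + v) D = witt_act u D + witt_act v D"
    by (simp add: witt_act_def act_d_minus_1_add scaleC_add_right distrib_right add_ac)
  show "witt_act (c *\<^sub>C u) D = c *\<^sub>C witt_act u D"
    by (simp add: witt_act_def act_d_minus_1_scaleC scaleC_add_right scaleC_scaleC mult_scaleC_left mult.commute)
  show "witt_act u (D + E) = witt_act u D + witt_act u E"
    by (simp add: witt_act_def witt_lead_add borel_part_add uea_gen_add distrib_left scaleC_add_left add_ac)
  show "witt_act u (c *\<^sub>C D) = c *\<^sub>C witt_act u D"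
    by (simp add: witt_act_def witt_lead_scaleC borel_part_scaleC uea_gen_scaleC scaleC_add_right
        scaleC_scaleC mult_scaleC_right)
  show "witt_act u (lie_bracket D E) = witt_act (witt_act u D) E - witt_act (witt_act u E) D"
    unfolding bracket_decomp[of D E] witt_act_def[of u "_ + _"]
      witt_lead_d_plus_borel borel_part_d_plus_borel
    by (simp add: witt_act_def act_d_minus_1_add act_d_minus_1_scaleC act_d_minus_1_mult_gen uea_gen_add uea_gen_diff
        uea_gen_scaleC mult_scaleC_left mult_scaleC_right scaleC_add_right scaleC_scaleC mult.commute
        complex_vector.scale_left_diff_distrib algebra_simps flip: uea_gen_bracket)
qed

lemma witt_act_Rep_borel: "witt_act u (Rep_borel y) = u * uea_gen y"
  by (simp add: witt_act_def witt_lead_Rep_borel borel_part_Rep_borel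
      complex_vector.scale_zero_left)

lemma witt_act_borel_incl: "witt.uea_act u (borel_incl v) = u * v"
proof (induction v rule: uea_induct)
  case (gen v y)
  then show ?case
    by (simp add: borel_incl_mult borel_incl_gen witt.uea_act_mult witt.uea_act_gen
        witt_act_Rep_borel mult.assoc)
qed (simp_all add: borel_incl_one witt.uea_act_one borel_incl_add witt.uea_act_add_right distrib_left
    borel_incl_scaleC witt.uea_act_scaleC_right mult_scaleC_right)

lemma witt_act_d_minus_1: "witt.uea_act 1 d\<^sub>-\<^sub>1 = 1"
proof -
  have "borel_part (d (-1)) = 0"
    using borel_part_d_plus_borel[of 1 0] by (simp add: zero_borel.rep_eq scaleC_one)
  moreover have "uea_gen (0 :: borel) = 0" using uea_gen_diff[of 0 0] by simp
  ultimately show ?thesis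
    by (simp add: witt.uea_act_gen witt_act_def witt_lead_d act_d_minus_1_one scaleC_one)
qed

lemma witt_act_ideal: "witt.uea_act 1 ((d\<^sub>-\<^sub>1 - 1) * w) = 0"
  by (simp add: witt.uea_act_mult witt.uea_act_diff_right witt_act_d_minus_1 witt.uea_act_one
      witt.uea_act_zero_left)

text \<open>Commute \<open>d\<^sub>-\<^sub>1\<close> to the left through \<open>u\<close> and replace it there by \<open>1\<close>; each commutator costs
  terms with fewer factors to the left of \<open>d\<^sub>-\<^sub>1\<close>.\<close>

lemma borel_incl_mult_d_minus_1: "\<exists>v w. borel_incl u * d\<^sub>-\<^sub>1 = borel_incl v + (d\<^sub>-\<^sub>1 - 1) * w"
proof (induction u rule: uea_induct)
  case one
  have "borel_incl 1 * d\<^sub>-\<^sub>1 = borel_incl 1 + (d\<^sub>-\<^sub>1 - 1) * 1" by (simp add: borel_incl_one)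
  then show ?case by blast
next
  case (gen u y)
  then obtain v w where vw: "borel_incl u * d\<^sub>-\<^sub>1 = borel_incl v + (d\<^sub>-\<^sub>1 - 1) * w" by blast
  let ?y = "uea_gen (Rep_borel y)"
  have "?y * d\<^sub>-\<^sub>1 = d\<^sub>-\<^sub>1 * ?y + (ad_lead y *\<^sub>C d\<^sub>-\<^sub>1 + uea_gen (Rep_borel (ad_borel y)))"
    using uea_gen_bracket[of "Rep_borel y" "d (-1)"]
    by (simp add: bracket_d_minus_1 uea_gen_add uea_gen_scaleC algebra_simps)
  then have "borel_incl (u * uea_gen y) * d\<^sub>-\<^sub>1
      = (borel_incl u * d\<^sub>-\<^sub>1) * ?y + ad_lead y *\<^sub>C (borel_incl u * d\<^sub>-\<^sub>1)
        + borel_incl (u * uea_gen (ad_borel y))"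
    by (simp add: borel_incl_mult borel_incl_gen mult.assoc distrib_left mult_scaleC_right)
  also have "\<dots> = borel_incl (v * uea_gen y + ad_lead y *\<^sub>C v + u * uea_gen (ad_borel y))
      + (d\<^sub>-\<^sub>1 - 1) * (w * ?y + ad_lead y *\<^sub>C w)"
    by (simp only: vw borel_incl_add borel_incl_mult borel_incl_gen borel_incl_scaleC distrib_left
        distrib_right scaleC_add_right mult_scaleC_right mult.assoc add_ac)
  finally show ?case by blast
next
  case (add u u')
  then obtain v w v' w' where "borel_incl u * d\<^sub>-\<^sub>1 = borel_incl v + (d\<^sub>-\<^sub>1 - 1) * w"
    "borel_incl u' * d\<^sub>-\<^sub>1 = borel_incl v' + (d\<^sub>-\<^sub>1 - 1) * w'" by blast
  then have "borel_incl (u + u') * d\<^sub>-\<^sub>1 = borel_incl (v + v') + (d\<^sub>-\<^sub>1 - 1) * (w + w')"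
    by (simp only: borel_incl_add distrib_left distrib_right add_ac)
  then show ?case by blast
next
  case (scaleC c u)
  then obtain v w where "borel_incl u * d\<^sub>-\<^sub>1 = borel_incl v + (d\<^sub>-\<^sub>1 - 1) * w" by blast
  then have "borel_incl (c *\<^sub>C u) * d\<^sub>-\<^sub>1 = borel_incl (c *\<^sub>C v) + (d\<^sub>-\<^sub>1 - 1) * (c *\<^sub>C w)"
    by (simp only: borel_incl_scaleC scaleC_add_right mult_scaleC_left mult_scaleC_right)
  then show ?case by blast
qed

text \<open>\<open>U(\<bb>) + J\<close> contains \<open>1\<close> and is stable under right multiplication by \<open>\<bb>\<close> and by \<open>d\<^sub>-\<^sub>1\<close>.\<close>

lemma uea_witt_decomp: "\<exists>u w. m = borel_incl u + (d\<^sub>-\<^sub>1 - 1) * w"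
proof (induction m rule: uea_induct)
  case one
  have "1 = borel_incl 1 + (d\<^sub>-\<^sub>1 - 1) * 0" by (simp add: borel_incl_one)
  then show ?case by blast
next
  case (gen m D)
  then obtain u w where m: "m = borel_incl u + (d\<^sub>-\<^sub>1 - 1) * w" by blast
  obtain v w' where v: "borel_incl u * d\<^sub>-\<^sub>1 = borel_incl v + (d\<^sub>-\<^sub>1 - 1) * w'"
    using borel_incl_mult_d_minus_1 by blast
  have "uea_gen D = witt_lead D *\<^sub>C d\<^sub>-\<^sub>1 + borel_incl (uea_gen (borel_part D))"
    by (metis witt_decomp uea_gen_add uea_gen_scaleC borel_incl_gen)
  then have "borel_incl u * uea_gen D = witt_lead D *\<^sub>C (borel_incl u * d\<^sub>-\<^sub>1)
      + borel_incl (u * uea_gen (borel_part D))"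
    by (simp add: distrib_left mult_scaleC_right borel_incl_mult)
  then have "m * uea_gen D = witt_lead D *\<^sub>C (borel_incl u * d\<^sub>-\<^sub>1)
      + borel_incl (u * uea_gen (borel_part D)) + (d\<^sub>-\<^sub>1 - 1) * (w * uea_gen D)"
    by (simp only: m distrib_right mult.assoc)
  also have "\<dots> = borel_incl (witt_lead D *\<^sub>C v + u * uea_gen (borel_part D))
      + (d\<^sub>-\<^sub>1 - 1) * (witt_lead D *\<^sub>C w' + w * uea_gen D)"
    by (simp only: v distrib_left scaleC_add_right mult_scaleC_right borel_incl_add borel_incl_scaleC add_ac)
  finally show ?case by blast
next
  case (add m m')
  then obtain v w v' w' where "m = borel_incl v + (d\<^sub>-\<^sub>1 - 1) * w"
    "m' = borel_incl v' + (d\<^sub>-\<^sub>1 - 1) * w'" by blast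
  then have "m + m' = borel_incl (v + v') + (d\<^sub>-\<^sub>1 - 1) * (w + w')"
    by (simp only: borel_incl_add distrib_left add_ac)
  then show ?case by blast
next
  case (scaleC c m)
  then obtain v w where "m = borel_incl v + (d\<^sub>-\<^sub>1 - 1) * w" by blast
  then have "c *\<^sub>C m = borel_incl (c *\<^sub>C v) + (d\<^sub>-\<^sub>1 - 1) * (c *\<^sub>C w)"
    by (simp only: borel_incl_scaleC scaleC_add_right mult_scaleC_right)
  then show ?case by blast
qed

text \<open>Acting on \<open>1\<close> is the projection onto \<open>U(\<bb>)\<close> along \<open>J\<close>; in particular its kernel is no larger
  than \<open>J\<close>.\<close>

lemma minus_borel_incl_witt_act: "\<exists>w. m - borel_incl (witt.uea_act 1 m) = (d\<^sub>-\<^sub>1 - 1) * w"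
proof -
  obtain u w where m: "m = borel_incl u + (d\<^sub>-\<^sub>1 - 1) * w" using uea_witt_decomp by blast
  have "witt.uea_act 1 m = u"
    by (simp only: m witt.uea_act_add_right witt_act_borel_incl witt_act_ideal) simp
  then show ?thesis using m by auto
qed


section \<open>The identification of \<open>Q\<^sub>1'\<close> with \<open>U(\<bb>)\<close>\<close>

text \<open>The map \<open>n \<otimes> m \<mapsto> n (1 \<cdot> m)\<close>, before passing to the quotient. It is balanced because a
  polynomial in \<open>d\<^sub>-\<^sub>1\<close> acts on \<open>1 \<in> U(\<bb>)\<close> by its value at \<open>1\<close>, as it does on \<open>v\<^sub>1\<close>.\<close>

definition tensor_coord :: "(complex \<times> witt uea \<Rightarrow>\<^sub>0 int) \<Rightarrow> borel uea" where
  "tensor_coord p = (\<Sum>k\<in>Poly_Mapping.keys p.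
     (of_int (Poly_Mapping.lookup p k) * fst k) *\<^sub>C witt.uea_act 1 (snd k))"

lemma tensor_coord_superset:
  assumes "finite A" "Poly_Mapping.keys p \<subseteq> A"
  shows "tensor_coord p = (\<Sum>k\<in>A.
     (of_int (Poly_Mapping.lookup p k) * fst k) *\<^sub>C witt.uea_act 1 (snd k))"
  unfolding tensor_coord_def using assms
  by (intro sum.mono_neutral_left) (auto simp: in_keys_iff)

lemma tensor_coord_diff: "tensor_coord (p - q) = tensor_coord p - tensor_coord q"
proof -
  let ?A = "Poly_Mapping.keys p \<union> Poly_Mapping.keys q"
  let ?f = "\<lambda>p k. (of_int (Poly_Mapping.lookup p k) * fst k) *\<^sub>C witt.uea_act 1 (snd k)"
  have "tensor_coord (p - q) = sum (?f (p - q)) ?A"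
    by (rule tensor_coord_superset) (use Poly_Mapping.keys_diff[of p q] in auto)
  moreover have "tensor_coord p = sum (?f p) ?A" "tensor_coord q = sum (?f q) ?A"
    by (rule tensor_coord_superset; auto)+
  ultimately show ?thesis
    by (simp add: lookup_minus left_diff_distrib complex_vector.scale_left_diff_distrib
        sum_subtractf)
qed

lemma tensor_coord_of: "tensor_coord (frag_of (n, m)) = n *\<^sub>C witt.uea_act 1 m"
  by (simp add: tensor_coord_def scaleC_one)

lemma witt_act_UW_left_act: "witt.uea_act 1 (UW_left_act p m) = poly p 1 *\<^sub>C witt.uea_act 1 m"
proof -
  have "witt.uea_act 1 (d\<^sub>-\<^sub>1 ^ i) = 1" for i
    by (induction i) (simp_all add: witt.uea_act_mult witt_act_d_minus_1 witt.uea_act_one)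
  then have "witt.uea_act 1 (poly_at p d\<^sub>-\<^sub>1) = poly p 1 *\<^sub>C 1"
    by (simp add: poly_at_def witt.uea_act_sum_right witt.uea_act_scaleC_right poly_altdef
        complex_vector.scale_sum_left)
  then show ?thesis
    by (simp add: UW_left_act_def witt.uea_act_mult witt.uea_act_scaleC_left)
qed

lemma tensor_coord_relations:
  "p \<in> tensor_relations N1_act UW_left_act \<Longrightarrow> tensor_coord p = 0"
proof (induction rule: tensor_relations.induct)
  case tensor_zero
  then show ?case by (simp add: tensor_coord_def)
qed (simp_all add: tensor_coord_diff tensor_coord_of scaleC_add_left scaleC_add_right
    witt.uea_act_add_right witt_act_UW_left_act N1_act_def scaleC_scaleC)

text \<open>An active lifting for enveloping algebras would also lift the codomain \<^typ>\<open>borel uea\<close>.\<close>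

lifting_forget uea.lifting

lift_definition Q1'_coord :: "Q1' \<Rightarrow> borel uea" is tensor_coord
  using tensor_coord_relations tensor_coord_diff by (metis eq_iff_diff_eq_0)

lemma Q1'_coord_tensor: "Q1'_coord (Q1'_tensor n m) = n *\<^sub>C witt.uea_act 1 m"
  by transfer (rule tensor_coord_of)

lemma Q1'_tensor_add_right: "Q1'_tensor n (m + m') = Q1'_tensor n m + Q1'_tensor n m'"
  by transfer (metis diff_diff_eq tensor_add_right)

lemma Q1'_tensor_diff_right: "Q1'_tensor n (m - m') = Q1'_tensor n m - Q1'_tensor n m'"
  using Q1'_tensor_add_right[of n "m - m'" m'] by simp

lemma Q1'_tensor_add_left: "Q1'_tensor (n + n') m = Q1'_tensor n m + Q1'_tensor n' m"
  by transfer (metis diff_diff_eq tensor_add_left)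

lemma Q1'_tensor_balanced: "Q1'_tensor (n * poly p 1) m = Q1'_tensor n (poly_at p d\<^sub>-\<^sub>1 * m)"
  by transfer (metis N1_act_def UW_left_act_def tensor_balanced)

text \<open>\<open>v\<^sub>1 \<otimes> (d\<^sub>-\<^sub>1 - 1) w = v\<^sub>1 (d\<^sub>-\<^sub>1 - 1) \<otimes> w\<close>, and \<open>d\<^sub>-\<^sub>1 - 1\<close> annihilates \<open>v\<^sub>1\<close>.\<close>

lemma Q1'_tensor_ideal: "Q1'_tensor n ((d\<^sub>-\<^sub>1 - 1) * w) = 0"
proof -
  have "poly_at [:-1, 1:] d\<^sub>-\<^sub>1 = d\<^sub>-\<^sub>1 - 1"
    by (simp add: poly_at_def scaleC_one complex_vector.scale_minus_left)
  moreover have "Q1'_tensor 0 w = 0" using Q1'_tensor_add_left[of 0 0 w] by simp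
  ultimately show ?thesis using Q1'_tensor_balanced[of n "[:-1, 1:]" w] by simp
qed

lemma Q1'_tensor_one: "Q1'_tensor n m = Q1'_tensor 1 (n *\<^sub>C m)"
  using Q1'_tensor_balanced[of 1 "[:n:]" m] by (simp add: poly_at_def mult_scaleC_left)

lemma Q1'_cases:
  obtains m where "q = Q1'_tensor 1 m"
proof -
  define cyclic where "cyclic p \<longleftrightarrow> (\<exists>m. abs_Q1' p = Q1'_tensor 1 m)" for p
  have "cyclic p" for p
  proof (rule frag_induction[of p UNIV])
    show "cyclic 0"
      unfolding cyclic_def zero_Q1'.abs_eq[symmetric] by (metis Q1'_tensor_diff_right diff_self)
    show "cyclic (frag_of x)" for x
      unfolding cyclic_def by (metis Q1'_tensor.abs_eq Q1'_tensor_one surj_pair)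
    show "cyclic (a - b)" if "cyclic a" "cyclic b" for a b
      using that unfolding cyclic_def minus_Q1'.abs_eq[symmetric] by (metis Q1'_tensor_diff_right)
  qed simp
  then have "cyclic (rep_Q1' q)" .
  then show thesis
    using that Quotient3_abs_rep[OF Quotient3_Q1', of q] by (auto simp: cyclic_def)
qed

lemma tensor_borel_incl_coord: "Q1'_tensor 1 (borel_incl (Q1'_coord q)) = q"
proof -
  obtain m where q: "q = Q1'_tensor 1 m" by (rule Q1'_cases)
  obtain w where "m - borel_incl (witt.uea_act 1 m) = (d\<^sub>-\<^sub>1 - 1) * w"
    using minus_borel_incl_witt_act by blast
  then have "Q1'_tensor 1 m - Q1'_tensor 1 (borel_incl (witt.uea_act 1 m)) = 0"
    by (metis Q1'_tensor_diff_right Q1'_tensor_ideal)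
  then show ?thesis unfolding q Q1'_coord_tensor scaleC_one by simp
qed

lemma Q1'_coord_tensor_borel_incl: "Q1'_coord (Q1'_tensor 1 (borel_incl u)) = u"
  by (simp add: Q1'_coord_tensor scaleC_one witt_act_borel_incl)


section \<open>The isomorphism\<close>

text \<open>Left multiplication by \<open>u \<in> H\<^sub>1\<close> preserves \<open>J\<close>, so on classes it may be computed on the
  representative in \<open>U(\<bb>)\<close>. The left-hand side is a function of the class by construction, and
  the right-hand side is visibly compatible with the right action.\<close>

lemma H1_tensor_mult:
  assumes "borel_incl u * (d\<^sub>-\<^sub>1 - 1) \<in> {(d\<^sub>-\<^sub>1 - 1) * w | w. True}"
  shows "Q1'_tensor 1 (borel_incl (u * Q1'_coord (Q1'_tensor 1 m))) = Q1'_tensor 1 (borel_incl u * m)"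
proof -
  from assms obtain z where z: "borel_incl u * (d\<^sub>-\<^sub>1 - 1) = (d\<^sub>-\<^sub>1 - 1) * z" by blast
  obtain w where "m - borel_incl (witt.uea_act 1 m) = (d\<^sub>-\<^sub>1 - 1) * w"
    using minus_borel_incl_witt_act by blast
  then have "borel_incl u * m - borel_incl (u * witt.uea_act 1 m) = borel_incl u * ((d\<^sub>-\<^sub>1 - 1) * w)"
    by (simp only: borel_incl_mult flip: right_diff_distrib)
  also have "\<dots> = (d\<^sub>-\<^sub>1 - 1) * (z * w)"
    by (simp only: z flip: mult.assoc)
  finally have "borel_incl u * m - borel_incl (u * witt.uea_act 1 m) = (d\<^sub>-\<^sub>1 - 1) * (z * w)" .
  then have "Q1'_tensor 1 (borel_incl u * m) - Q1'_tensor 1 (borel_incl (u * witt.uea_act 1 m)) = 0"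
    by (metis Q1'_tensor_diff_right Q1'_tensor_ideal)
  then show ?thesis by (simp add: Q1'_coord_tensor scaleC_one)
qed

lift_definition H1_endo :: "H1 \<Rightarrow> H1'" is "\<lambda>u q. Q1'_tensor 1 (borel_incl (u * Q1'_coord q))"
proof (intro CollectI conjI allI)
  fix u :: "borel uea" and p q :: Q1' and x :: "witt uea"
  assume u: "borel_incl u * (d\<^sub>-\<^sub>1 - 1) \<in> {(d\<^sub>-\<^sub>1 - 1) * w | w. True}"
  obtain m n where pq: "p = Q1'_tensor 1 m" "q = Q1'_tensor 1 n" using Q1'_cases by metis
  show "Q1'_tensor 1 (borel_incl (u * Q1'_coord (p + q)))
      = Q1'_tensor 1 (borel_incl (u * Q1'_coord p)) + Q1'_tensor 1 (borel_incl (u * Q1'_coord q))"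
    unfolding pq Q1'_tensor_add_right[symmetric] H1_tensor_mult[OF u] distrib_left ..
  show "Q1'_tensor 1 (borel_incl (u * Q1'_coord (q \<cdot> x)))
      = Q1'_tensor 1 (borel_incl (u * Q1'_coord q)) \<cdot> x"
    unfolding pq Q1'_tensor_act H1_tensor_mult[OF u] mult.assoc ..
qed

lemma H1_endo_coord: "Q1'_coord (Rep_H1' (H1_endo h) q) = Rep_H1 h * Q1'_coord q"
  by (simp add: H1_endo.rep_eq Q1'_coord_tensor_borel_incl)

lemma H1_endo_tensor: "Rep_H1' (H1_endo h) (Q1'_tensor 1 m) = Q1'_tensor 1 (borel_incl (Rep_H1 h) * m)"
  unfolding H1_endo.rep_eq by (rule H1_tensor_mult) (use Rep_H1 in blast)

lemma Q1'_coord_inject: "Q1'_coord p = Q1'_coord q \<longleftrightarrow> p = q"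
  by (metis tensor_borel_incl_coord)

lemma H1'_eqI:
  assumes "\<And>q. Q1'_coord (Rep_H1' f q) = Q1'_coord (Rep_H1' g q)"
  shows "f = g"
  using assms by (metis Q1'_coord_inject Rep_H1'_inject ext)

lemma Q1'_coord_add: "Q1'_coord (p + q) = Q1'_coord p + Q1'_coord q"
  by (cases p rule: Q1'_cases; cases q rule: Q1'_cases)
    (simp add: Q1'_coord_tensor witt.uea_act_add_right scaleC_one flip: Q1'_tensor_add_right)

lemma Q1'_coord_scaleC: "Q1'_coord (c *\<^sub>C q) = c *\<^sub>C Q1'_coord q"
  by (cases q rule: Q1'_cases)
    (simp add: scaleC_Q1'_def Q1'_tensor_act mult_scaleC_right Q1'_coord_tensor
      witt.uea_act_scaleC_right scaleC_one)

lemma inj_H1_endo: "inj H1_endo"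
proof (rule injI)
  fix g h assume "H1_endo g = H1_endo h"
  then have "Rep_H1 g * Q1'_coord (Q1'_tensor 1 1) = Rep_H1 h * Q1'_coord (Q1'_tensor 1 1)"
    by (metis H1_endo_coord)
  then show "g = h" by (simp add: Q1'_coord_tensor witt.uea_act_one scaleC_one Rep_H1_inject)
qed

text \<open>Take the representative \<open>u \<in> U(\<bb>)\<close> of \<open>f(1 \<otimes> 1)\<close>. Since \<open>1 \<otimes> (d\<^sub>-\<^sub>1 - 1) = 0\<close>, also
  \<open>1 \<otimes> u (d\<^sub>-\<^sub>1 - 1) = f(1 \<otimes> 1) \<cdot> (d\<^sub>-\<^sub>1 - 1) = 0\<close>, and a vanishing class lies in \<open>J\<close>; hence
  \<open>u \<in> H\<^sub>1\<close>.\<close>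

lemma surj_H1_endo: "surj H1_endo"
proof (rule surjI)
  fix f :: H1'
  have f: "Rep_H1' f (q \<cdot> x) = Rep_H1' f q \<cdot> x" for q x using Rep_H1'[of f] by blast
  define u where "u = Q1'_coord (Rep_H1' f (Q1'_tensor 1 1))"
  have fm: "Rep_H1' f (Q1'_tensor 1 m) = Q1'_tensor 1 (borel_incl u * m)" for m
  proof -
    have "Rep_H1' f (Q1'_tensor 1 m) = Rep_H1' f (Q1'_tensor 1 1) \<cdot> m"
      using f[of "Q1'_tensor 1 1" m] by (simp add: Q1'_tensor_act)
    also have "Rep_H1' f (Q1'_tensor 1 1) = Q1'_tensor 1 (borel_incl u)"
      by (simp add: u_def tensor_borel_incl_coord)
    finally show ?thesis by (simp add: Q1'_tensor_act)
  qed
  have "Q1'_tensor 1 (borel_incl u * (d\<^sub>-\<^sub>1 - 1)) = Rep_H1' f 0"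
    using fm[of "d\<^sub>-\<^sub>1 - 1"] Q1'_tensor_ideal[of 1 1] by simp
  also have "\<dots> = 0" using Rep_H1'_linear(1)[of f 0 0] by simp
  finally have "Q1'_coord (Q1'_tensor 1 (borel_incl u * (d\<^sub>-\<^sub>1 - 1))) = Q1'_coord 0" by simp
  also have "Q1'_coord 0 = 0" using Q1'_coord_add[of 0 0] by simp
  finally have "witt.uea_act 1 (borel_incl u * (d\<^sub>-\<^sub>1 - 1)) = 0"
    by (simp add: Q1'_coord_tensor scaleC_one)
  then have u: "borel_incl u * (d\<^sub>-\<^sub>1 - 1) \<in> {(d\<^sub>-\<^sub>1 - 1) * w | w. True}"
    using minus_borel_incl_witt_act[of "borel_incl u * (d\<^sub>-\<^sub>1 - 1)"] by (auto simp: borel_incl_zero)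
  have Rep_u: "Rep_H1 (Abs_H1 u) = u" by (rule Abs_H1_inverse) (use u in simp)
  have "H1_endo (Abs_H1 u) = f"
  proof (rule H1'_eqI)
    fix q
    obtain m where "q = Q1'_tensor 1 m" by (rule Q1'_cases)
    then show "Q1'_coord (Rep_H1' (H1_endo (Abs_H1 u)) q) = Q1'_coord (Rep_H1' f q)"
      by (simp add: H1_endo_tensor fm Rep_u)
  qed
  then show "H1_endo (Abs_H1 (Q1'_coord (Rep_H1' f (Q1'_tensor 1 1)))) = f"
    by (simp add: u_def)
qed

theorem lemma3p16:
  shows "\<exists>\<phi> :: H1 \<Rightarrow> H1'. algebra_iso \<phi>"
proof
  show "algebra_iso H1_endo"
    unfolding algebra_iso_def
  proof (intro conjI allI)
    show "bij H1_endo" using inj_H1_endo surj_H1_endo by (rule bijI)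
    show "H1_endo (x + y) = H1_endo x + H1_endo y" for x y
      by (rule H1'_eqI)
        (simp add: plus_H1'.rep_eq Q1'_coord_add H1_endo_coord plus_H1.rep_eq distrib_right)
    show "H1_endo (c *\<^sub>C x) = c *\<^sub>C H1_endo x" for c x
      by (rule H1'_eqI)
        (simp add: scaleC_H1'.rep_eq Q1'_coord_scaleC H1_endo_coord scaleC_H1.rep_eq mult_scaleC_left)
    show "H1_endo (x * y) = H1_endo x * H1_endo y" for x y
      by (rule H1'_eqI) (simp add: times_H1'.rep_eq H1_endo_coord times_H1.rep_eq mult.assoc)
    show "H1_endo 1 = 1"
      by (rule H1'_eqI) (simp add: one_H1'.rep_eq H1_endo_coord one_H1.rep_eq)
  qed
qed

end
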